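(* The adversarial problem of the recoverable robust representatives multi-selection problem with discrete budgeted uncertainty can be solved in strongly polynomial time. That is, there is a strongly polynomial time algorithm which, given an instance $(n, T_1,\ldots,T_K, p_1,\ldots,p_K, \underline{c}, d, \Gamma, k)$ and a first-stage solution $x\in\mathcal{X}$, computes $$\textsc{Adv}(x) = \max_{c\in\mathcal{U}}\ \min_{y\in R(x)} \sum_{i\in[n]} c_i y_i .$$
   Context: Notation: $[n]=\{1,\ldots,n\}$. The item set $[n]$ is partitioned into disjoint parts $T_1,\ldots,T_K$, with $n_j=|T_j|$, and integers $0\le p_j\le n_j$ are given. The set of feasible solutions is $\mathcal{X}=\{x\in\{0,1\}^n : \sum_{i\in T_j}x_i=p_j \ \forall j\in[K]\}$. Discrete budgeted uncertainty: given $\underline{c}\in\mathbb{R}^n$, $d\in\mathbb{R}^n$ with $d_i\ge 0$, and a nonnegative integer $\Gamma$, $$\mathcal{U}=\Big\{c\in\mathbb{R}^n : c_i=\underline{c}_i+d_i\delta_i,\ \delta_i\in\{0,1\},\ \sum_{i\in[n]}\delta_i\le\Gamma\Big\}.$$ Recovery: given a nonnegative integer $k$, $R(x)=\{y\in\mathcal{X} : \sum_{i\in[n]}|x_i-y_i|\le 2k\}$ for $x\in\mathcal{X}$. The adversarial problem is: given $x\in\mathcal{X}$, compute $\textsc{Adv}(x)$. (The full recoverable robust problem is $\min_{x\in\mathcal{X}}\sum_i C_ix_i+\textsc{Adv}(x)$, for given first-stage costs $C$.) Strongly polynomial means that the number of elementary arithmetic operations and comparisons is bounded by a polynomial in $n$,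 independently of the sizes of the numbers, and the algorithm runs in polynomial space on rational input. *)

theory Defs
  imports Complex_Main "HOL-Library.FuncSet" "HOL-Library.Disjoint_Sets" "HOL-Library.Log_Nat"
    "HOL-Computational_Algebra.Polynomial"
begin

text \<open>
  Strongly polynomial time is defined by means of a structured random access machine over the
  reals. Its state has scalar registers and arrays; registers and arrays are named by natural
  numbers that are fixed in the program text, whereas the position inside an array is computed
  at run time. Array indices are ordinary numbers held in registers, so index computations are
  charged like any other arithmetic. Every instruction, comparison and branch takes at least
  one step. There is no rounding operation and there are no real constants.
\<close>

record machine_state =
  regs :: "nat \<Rightarrow> real"
  arrs :: "nat \<Rightarrow> nat \<Rightarrow> real"

datatype arith_op = Plus | Minus | Times | Divide

datatype instr =
    Const nat int
  | Move nat nat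
  | Arith arith_op nat nat nat
  | Load nat nat nat    (* Load r a i:  r := a[i] *)
  | Store nat nat nat   (* Store a i r:  a[i] := r *)

fun arith :: "arith_op \<Rightarrow> real \<Rightarrow> real \<Rightarrow> real" where
  "arith Plus u v = u + v"
| "arith Minus u v = u - v"
| "arith Times u v = u * v"
| "arith Divide u v = u / v"

text \<open>
  The value \<open>None\<close> models a fault: division by zero, or an array index that is not a natural
  number.
\<close>

fun exec :: "instr \<Rightarrow> machine_state \<Rightarrow> machine_state option" where
  "exec (Const r z) s = Some (s\<lparr>regs := (regs s)(r := of_int z)\<rparr>)"
| "exec (Move r u) s = Some (s\<lparr>regs := (regs s)(r := regs s u)\<rparr>)"
| "exec (Arith f r u v) s =
    (if f = Divide \<and> regs s v = 0 then None
     else Some (s\<lparr>regs := (regs s)(r := arith f (regs s u) (regs s v))\<rparr>))"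
| "exec (Load r a i) s =
    (if regs s i \<in> \<nat>
     then Some (s\<lparr>regs := (regs s)(r := arrs s a (nat \<lfloor>regs s i\<rfloor>))\<rparr>)
     else None)"
| "exec (Store a i r) s =
    (if regs s i \<in> \<nat>
     then Some (s\<lparr>arrs := (arrs s)(a := (arrs s a)(nat \<lfloor>regs s i\<rfloor> := regs s r))\<rparr>)
     else None)"

datatype program =
    Skip
  | Do instr
  | Seq program program
  | IfLe nat nat program program
  | WhileLess nat nat program

inductive step :: "program \<times> machine_state \<Rightarrow> program \<times> machine_state \<Rightarrow> bool" where
  Do: "exec i s = Some s' \<Longrightarrow> step (Do i, s) (Skip, s')"
| Seq_Skip: "step (Seq Skip P, s) (P, s)"
| Seq_step: "step (P, s) (P', s') \<Longrightarrow> step (Seq P Q, s) (Seq P' Q, s')"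
| If_True: "regs s u \<le> regs s v \<Longrightarrow> step (IfLe u v P Q, s) (P, s)"
| If_False: "\<not> regs s u \<le> regs s v \<Longrightarrow> step (IfLe u v P Q, s) (Q, s)"
| While_True:
    "regs s u < regs s v \<Longrightarrow> step (WhileLess u v P, s) (Seq P (WhileLess u v P), s)"
| While_False: "\<not> regs s u < regs s v \<Longrightarrow> step (WhileLess u v P, s) (Skip, s)"

lemma step_deterministic:
  assumes "step C C1" "step C C2"
  shows "C1 = C2"
  using assms
proof (induction arbitrary: C2 rule: step.induct)
  case (Seq_step P s P' s' Q)
  from Seq_step.prems Seq_step.hyps show ?case
    by (cases rule: step.cases) (auto elim: step.cases dest: Seq_step.IH)
qed (auto elim: step.cases)

text \<open>
  The input is a list of number sequences; the \<open>a\<close>-th sequence is initially stored in array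
  \<open>a\<close>, and everything else is zero.
\<close>

definition initial_state :: "real list list \<Rightarrow> machine_state" where
  "initial_state inp =
    \<lparr>regs = (\<lambda>_. 0),
     arrs = (\<lambda>a i. if a < length inp \<and> i < length (inp ! a) then inp ! a ! i else 0)\<rparr>"

text \<open>
  Binary encoding length of a rational number (sign, numerator, denominator in lowest terms);
  it is meaningful only for \<open>x \<in> \<rat>\<close>. Note that \<open>floorlog 2 m\<close> is the number of binary digits
  of \<open>m\<close>.
\<close>

definition number_size :: "real \<Rightarrow> nat" where
  "number_size x =
    (let (a, b) = quotient_of (the_inv real_of_rat x)
     in 1 + floorlog 2 (nat \<bar>a\<bar>) + floorlog 2 (nat b))"

definition input_size :: "real list list \<Rightarrow> nat" where
  "input_size inp = (\<Sum>x\<leftarrow>concat inp. number_size x)"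

text \<open>
  Space occupied by a state: an array is charged for its nonzero cells, each with its address.
  The sums are finite because only finitely many cells are nonzero in any state that can be
  reached from an initial state.
\<close>

definition state_size :: "machine_state \<Rightarrow> nat" where
  "state_size s =
    (\<Sum>r | regs s r \<noteq> 0. number_size (regs s r)) +
    (\<Sum>(a, i)\<in>{(a, i). arrs s a i \<noteq> 0}. floorlog 2 i + number_size (arrs s a i))"

text \<open>
  A function \<open>f\<close> on a set \<open>Inst\<close> of instances is computed by one and the same program on all
  instances (result in register 0), such that the number of steps is polynomial in the
  dimension \<open>dimension\<close>, for arbitrary real data, and the space used on rational data is polynomial
  in the encoding length of the input.
\<close>

definition strongly_polynomial_time ::
  "'i set \<Rightarrow> ('i \<Rightarrow> nat) \<Rightarrow> ('i \<Rightarrow> real list list) \<Rightarrow> ('i \<Rightarrow> real) \<Rightarrow> bool" where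
  "strongly_polynomial_time Inst dimension enc f \<longleftrightarrow>
    (\<exists>P. \<exists>time space :: nat poly. \<forall>I\<in>Inst.
      (\<exists>t s. t \<le> poly time (dimension I) \<and>
         (step ^^ t) (P, initial_state (enc I)) (Skip, s) \<and> regs s 0 = f I) \<and>
      (set (concat (enc I)) \<subseteq> \<rat> \<longrightarrow>
         (\<forall>P' s. step\<^sup>*\<^sup>* (P, initial_state (enc I)) (P', s) \<longrightarrow>
            state_size s \<le> poly space (input_size (enc I)))))"


text \<open>
  Vectors indexed by \<open>[n] = {1..n}\<close> are functions that are extensional on \<open>{1..n}\<close>, so
  that the solution set, the recovery set and the uncertainty set are finite.
\<close>

record rms_instance =
  num_items :: nat               (* n *)
  num_parts :: nat               (* K *)
  part :: "nat \<Rightarrow> nat set"       (* T_1, ..., T_K *)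
  demand :: "nat \<Rightarrow> nat"         (* p_1, ..., p_K *)
  base_cost :: "nat \<Rightarrow> real"     (* lower costs, underlined c *)
  deviation :: "nat \<Rightarrow> real"     (* d *)
  budget :: nat                  (* Gamma *)
  recovery :: nat                (* k *)

definition items :: "rms_instance \<Rightarrow> nat set" where
  "items I = {1..num_items I}"

definition valid_instance :: "rms_instance \<Rightarrow> bool" where
  "valid_instance I \<longleftrightarrow>
    (\<Union>j\<in>{1..num_parts I}. part I j) = items I \<and>
    disjoint_family_on (part I) {1..num_parts I} \<and>
    (\<forall>j\<in>{1..num_parts I}. demand I j \<le> card (part I j)) \<and>
    (\<forall>i\<in>items I. deviation I i \<ge> 0)"

definition feasible :: "rms_instance \<Rightarrow> (nat \<Rightarrow> real) set" where
  "feasible I =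
    {x \<in> items I \<rightarrow>\<^sub>E {0, 1}. \<forall>j\<in>{1..num_parts I}. (\<Sum>i\<in>part I j. x i) = real (demand I j)}"

definition uncertainty_set :: "rms_instance \<Rightarrow> (nat \<Rightarrow> real) set" where
  "uncertainty_set I =
    {(\<lambda>i\<in>items I. base_cost I i + deviation I i * \<delta> i) | \<delta>.
       \<delta> \<in> items I \<rightarrow>\<^sub>E {0, 1} \<and> (\<Sum>i\<in>items I. \<delta> i) \<le> real (budget I)}"

definition recovery_set :: "rms_instance \<Rightarrow> (nat \<Rightarrow> real) \<Rightarrow> (nat \<Rightarrow> real) set" where
  "recovery_set I x =
    {y \<in> feasible I. (\<Sum>i\<in>items I. \<bar>x i - y i\<bar>) \<le> 2 * real (recovery I)}"

definition Adv :: "rms_instance \<Rightarrow> (nat \<Rightarrow> real) \<Rightarrow> real" where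
  "Adv I x = (MAX c\<in>uncertainty_set I. MIN y\<in>recovery_set I x. \<Sum>i\<in>items I. c i * y i)"

lemma finite_feasible: "finite (feasible I)"
  unfolding feasible_def items_def by (simp add: finite_PiE)

lemma finite_recovery_set: "finite (recovery_set I x)"
  unfolding recovery_set_def by (simp add: finite_feasible)

lemma recovery_set_nonempty: "x \<in> feasible I \<Longrightarrow> recovery_set I x \<noteq> {}"
  unfolding recovery_set_def by (auto intro!: exI[of _ x])

lemma finite_uncertainty_set: "finite (uncertainty_set I)"
proof -
  have "uncertainty_set I \<subseteq>
    (\<lambda>\<delta>. \<lambda>i\<in>items I. base_cost I i + deviation I i * \<delta> i) ` (items I \<rightarrow>\<^sub>E {0, 1})"
    unfolding uncertainty_set_def by blast
  moreover have "finite (items I \<rightarrow>\<^sub>E {0, 1 :: real})"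
    unfolding items_def by (simp add: finite_PiE)
  ultimately show ?thesis
    using finite_surj by blast
qed

lemma uncertainty_set_nonempty: "uncertainty_set I \<noteq> {}"
  unfolding uncertainty_set_def by (auto intro!: exI[of _ "\<lambda>i\<in>items I. 0"])

definition part_index :: "rms_instance \<Rightarrow> nat \<Rightarrow> nat" where
  "part_index I i = (THE j. j \<in> {1..num_parts I} \<and> i \<in> part I j)"

text \<open>
  The partition is presented to the machine by the index of the part containing each item. The
  sequences are stored from position 0, hence the entry of item \<open>i\<close> is at position \<open>i - 1\<close>.
\<close>

definition encode :: "rms_instance \<Rightarrow> (nat \<Rightarrow> real) \<Rightarrow> real list list" where
  "encode I x =
    (let ns = [1..<num_items I + 1]; ks = [1..<num_parts I + 1] in
     [[real (num_items I), real (num_parts I), real (budget I), real (recovery I)],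
      map (\<lambda>i. real (part_index I i)) ns,
      map (\<lambda>j. real (demand I j)) ks,
      map (base_cost I) ns,
      map (deviation I) ns,
      map x ns])"

definition adversarial_inputs :: "(rms_instance \<times> (nat \<Rightarrow> real)) set" where
  "adversarial_inputs = {(I, x). valid_instance I \<and> x \<in> feasible I}"

end

theory Submission imports Defs begin

text \<open>
  For fixed costs, recovery is a linear program. Its dual has a multiplier \<open>lam\<close> for the distance
  bound and a multiplier for each part; an exchange argument shows that the optimum is attained
  with \<open>lam = max 0 (v - v')\<close> and multipliers of the parts in \<open>{v, v + lam}\<close>, where \<open>v\<close>
  and \<open>v'\<close> are among the \<open>2 n\<close> possible item costs. The adversarial problem thus becomes a pure
  maximization over \<open>lam\<close>, the multipliers of the parts and the deviating items. For fixed \<open>lam\<close>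
  the parts interact only through the budget, so that a dynamic program over the budget solves it.
  It only adds, subtracts and compares numbers, and for such a program polynomial time
  already implies polynomial space. Empty parts are not visited, since their number is not bounded
  in terms of \<open>n\<close>.
\<close>

section \<open>Structured programs\<close>

text \<open>Dualizing turns the inner minimum into a maximum, but the optimal multipliers depend on
  the set of deviating items, which is itself sought. What helps is that they can be taken from
  lists fixed in advance: every cost is some \<open>c i\<close> or \<open>c i + d i\<close>, so
  \<open>4 n^2\<close> pairs suffice for \<open>lam\<close> and, given \<open>lam\<close>,
  \<open>4 n\<close> values for each part. The lists also contain combinations that no single
  deviating set produces; by weak duality each of these merely yields another lower bound on the
  adversarial value. Linear programming duality is not invoked: the multipliers are built from an
  optimal recovery set by exchanging items, so integrality is never an issue. The machine model adds
  its own obstacle, since no loop length may depend on the sizes of the budget and of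
  \<open>k\<close>. Both can be capped at \<open>n\<close>: no more than \<open>n\<close> items can
  deviate or be exchanged. The product of the capped \<open>k\<close> and \<open>lam\<close> is
  formed by repeated addition, which stays within the reach of the space argument.\<close>

datatype code =
    Nop
  | Block "instr list"
  | Then code code (infixr ";;" 60)
  | If nat nat code code
  | For nat nat code

text \<open>Register 1 is reserved for the increment of loop counters.\<close>

fun block :: "instr list \<Rightarrow> program" where
  "block [] = Skip"
| "block (i # is) = Seq (Do i) (block is)"

fun compile :: "code \<Rightarrow> program" where
  "compile Nop = Skip"
| "compile (Block is) = block is"
| "compile (c ;; d) = Seq (compile c) (compile d)"
| "compile (If u v c d) = IfLe u v (compile c) (compile d)"
| "compile (For i u c) =
    Seq (Do (Const i 0))
      (WhileLess i u (Seq (compile c) (Seq (Do (Const 1 1)) (Do (Arith Plus i i 1)))))"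

fun exec_list :: "instr list \<Rightarrow> machine_state \<Rightarrow> machine_state option" where
  "exec_list [] s = Some s"
| "exec_list (i # is) s = (case exec i s of None \<Rightarrow> None | Some s' \<Rightarrow> exec_list is s')"

text \<open>Step bound as a polynomial in \<open>n\<close>, provided no loop makes more than \<open>4 n + 1\<close> rounds.\<close>

fun cost :: "code \<Rightarrow> nat poly" where
  "cost Nop = 0"
| "cost (Block is) = [:2 * length is:]"
| "cost (c ;; d) = cost c + cost d + 1"
| "cost (If u v c d) = cost c + cost d + 1"
| "cost (For i u c) = [:1, 4:] * (cost c + [:6:]) + [:3:]"

fun written_reg :: "instr \<Rightarrow> nat set" where
  "written_reg (Const r _) = {r}"
| "written_reg (Move r _) = {r}"
| "written_reg (Arith _ r _ _) = {r}"
| "written_reg (Load r _ _) = {r}"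
| "written_reg (Store _ _ _) = {}"

fun written_arr :: "instr \<Rightarrow> nat set" where
  "written_arr (Store a _ _) = {a}"
| "written_arr _ = {}"

fun written_regs :: "code \<Rightarrow> nat set" where
  "written_regs Nop = {}"
| "written_regs (Block is) = \<Union>(set (map written_reg is))"
| "written_regs (c ;; d) = written_regs c \<union> written_regs d"
| "written_regs (If u v c d) = written_regs c \<union> written_regs d"
| "written_regs (For i u c) = insert 1 (insert i (written_regs c))"

fun written_arrs :: "code \<Rightarrow> nat set" where
  "written_arrs Nop = {}"
| "written_arrs (Block is) = \<Union>(set (map written_arr is))"
| "written_arrs (c ;; d) = written_arrs c \<union> written_arrs d"
| "written_arrs (If u v c d) = written_arrs c \<union> written_arrs d"
| "written_arrs (For i u c) = written_arrs c"

section \<open>Step counts, frames and proof rules for compiled code\<close>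

abbreviation runs :: "program \<Rightarrow> machine_state \<Rightarrow> nat \<Rightarrow> program \<Rightarrow> machine_state \<Rightarrow> bool" where
  "runs P s t P' s' \<equiv> (step ^^ t) (P, s) (P', s')"

lemma runs_Seq_context: "runs P s t P' s' \<Longrightarrow> runs (Seq P Q) s t (Seq P' Q) s'"
proof (induction t arbitrary: P' s')
  case (Suc t)
  then obtain P1 s1 where 1: "runs P s t P1 s1" "step (P1, s1) (P', s')"
    by (auto simp: relcompp_apply)
  show ?case using Suc.IH[OF 1(1)] step.Seq_step[OF 1(2), of Q] by auto
qed auto

lemma runs_trans: "runs P s t P1 s1 \<Longrightarrow> runs P1 s1 u P2 s2 \<Longrightarrow> runs P s (t + u) P2 s2"
  by (auto simp: relpowp_add)

lemma runs_step: "step (P, s) (P1, s1) \<Longrightarrow> runs P1 s1 u P2 s2 \<Longrightarrow> runs P s (Suc u) P2 s2"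
  by (meson relpowp_Suc_I2)

lemma runs_Seq:
  assumes "runs P s t Skip s1" "runs Q s1 u R s2"
  shows "runs (Seq P Q) s (t + u + 1) R s2"
  using runs_trans[OF runs_Seq_context[OF assms(1)] runs_step[OF step.Seq_Skip assms(2)]] by simp

lemma runs_Do: "exec i s = Some s' \<Longrightarrow> runs (Do i) s 1 Skip s'"
  using step.Do by auto

definition frame :: "nat set \<Rightarrow> nat set \<Rightarrow> machine_state \<Rightarrow> machine_state \<Rightarrow> bool" where
  "frame R A s s' \<longleftrightarrow> (\<forall>r. r \<notin> R \<longrightarrow> regs s' r = regs s r) \<and> (\<forall>a. a \<notin> A \<longrightarrow> arrs s' a = arrs s a)"

lemma frame_refl: "frame R A s s" by (simp add: frame_def)

lemma frame_trans:
  "frame R A s s' \<Longrightarrow> frame R' A' s' s'' \<Longrightarrow> R \<subseteq> R'' \<Longrightarrow> R' \<subseteq> R'' \<Longrightarrow> A \<subseteq> A'' \<Longrightarrow> A' \<subseteq> A''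
    \<Longrightarrow> frame R'' A'' s s''"
  unfolding frame_def by (metis subsetD)

lemma frame_mono: "frame R A s s' \<Longrightarrow> R \<subseteq> R' \<Longrightarrow> A \<subseteq> A' \<Longrightarrow> frame R' A' s s'"
  unfolding frame_def by (metis subsetD)

lemma frame_regs: "frame R A s s' \<Longrightarrow> r \<notin> R \<Longrightarrow> regs s' r = regs s r"
  by (auto simp: frame_def)

lemma frame_exec: "exec i s = Some s' \<Longrightarrow> frame (written_reg i) (written_arr i) s s'"
  by (cases i) (auto simp: frame_def split: if_splits)

lemma frame_exec_list:
  "exec_list is s = Some s' \<Longrightarrow>
    frame (\<Union>(set (map written_reg is))) (\<Union>(set (map written_arr is))) s s'"
proof (induction "is" arbitrary: s)
  case (Cons i "is")
  then obtain s1 where 1: "exec i s = Some s1" "exec_list is s1 = Some s'"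
    by (auto split: option.splits)
  show ?case by (rule frame_trans[OF frame_exec[OF 1(1)] Cons.IH[OF 1(2)]]) auto
qed (simp add: frame_refl)

text \<open>Total correctness from one start state. The time bound and the frame are built in, so
  that each specification needs to mention only what changes.\<close>

definition achieves :: "nat \<Rightarrow> code \<Rightarrow> machine_state \<Rightarrow> (machine_state \<Rightarrow> bool) \<Rightarrow> bool" where
  "achieves n c s Q \<longleftrightarrow> (\<exists>t s'. t \<le> poly (cost c) n \<and> runs (compile c) s t Skip s' \<and>
     frame (written_regs c) (written_arrs c) s s' \<and> Q s')"

lemma achieves_conseq: 
  assumes "achieves n c s Q" "\<And>s'. Q s' \<Longrightarrow> frame (written_regs c) (written_arrs c) s s' \<Longrightarrow> Q' s'"
  shows "achieves n c s Q'"
  using assms unfolding achieves_def by blast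

lemma achieves_Nop: "Q s \<Longrightarrow> achieves n Nop s Q"
  unfolding achieves_def by (auto intro!: exI[of _ 0] simp: frame_refl)

lemma runs_block:
  "exec_list is s = Some s' \<Longrightarrow> runs (block is) s (2 * length is) Skip s'"
proof (induction "is" arbitrary: s)
  case (Cons i "is")
  then obtain s1 where 1: "exec i s = Some s1" "exec_list is s1 = Some s'"
    by (auto split: option.splits)
  show ?case using runs_Seq[OF runs_Do[OF 1(1)] Cons.IH[OF 1(2)]] by simp
qed simp

lemma achieves_Block:
  "(case exec_list is s of None \<Rightarrow> False | Some s' \<Rightarrow> Q s') \<Longrightarrow> achieves n (Block is) s Q"
  unfolding achieves_def
  using runs_block[of "is" s] frame_exec_list[of "is" s]
  by (auto split: option.splits intro!: exI[of _ "2 * length is"])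

lemma achieves_Then:
  assumes "achieves n c s (\<lambda>s'. achieves n d s' Q)"
  shows "achieves n (c ;; d) s Q"
proof -
  obtain t s1 where 1: "t \<le> poly (cost c) n" "runs (compile c) s t Skip s1"
    "frame (written_regs c) (written_arrs c) s s1" "achieves n d s1 Q"
    using assms unfolding achieves_def by blast
  then obtain u s2 where 2: "u \<le> poly (cost d) n" "runs (compile d) s1 u Skip s2"
    "frame (written_regs d) (written_arrs d) s1 s2" "Q s2"
    unfolding achieves_def by blast
  show ?thesis
    unfolding achieves_def
    using runs_Seq[OF 1(2) 2(2)] 1(1) 2(1,4) frame_trans[OF 1(3) 2(3)]
    by (intro exI[of _ "t + u + 1"] exI[of _ s2]) auto
qed

lemma achieves_If:
  assumes "regs s u \<le> regs s v \<Longrightarrow> achieves n c s Q" "\<not> regs s u \<le> regs s v \<Longrightarrow> achieves n d s Q"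
  shows "achieves n (If u v c d) s Q"
proof (cases "regs s u \<le> regs s v")
  case True
  from assms(1)[OF True] obtain t s' where 1: "t \<le> poly (cost c) n" "runs (compile c) s t Skip s'"
    "frame (written_regs c) (written_arrs c) s s'" "Q s'"
    unfolding achieves_def by blast
  show ?thesis unfolding achieves_def
    using runs_step[OF step.If_True[OF True] 1(2)] 1(1,4) frame_mono[OF 1(3)]
    by (intro exI[of _ "Suc t"] exI[of _ s']) auto
next
  case False
  from assms(2)[OF False] obtain t s' where 1: "t \<le> poly (cost d) n" "runs (compile d) s t Skip s'"
    "frame (written_regs d) (written_arrs d) s s'" "Q s'"
    unfolding achieves_def by blast
  show ?thesis unfolding achieves_def
    using runs_step[OF step.If_False[OF False] 1(2)] 1(1,4) frame_mono[OF 1(3)]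
    by (intro exI[of _ "Suc t"] exI[of _ s']) auto
qed

text \<open>The loop itself overwrites the counter and register 1 after each round;
  \<open>insens\<close> makes the invariant survive this, and the body learns the counter only from
  \<open>regs s i = real m\<close>. The bound \<open>4 n + 1\<close> covers the longest loops:
  \<open>4 n\<close> candidate multipliers, and the \<open>n + 1\<close> budgets even when
  \<open>n = 0\<close>.\<close>

lemma achieves_For:
  fixes Inv :: "nat \<Rightarrow> machine_state \<Rightarrow> bool"
  assumes wf: "i \<notin> written_regs c" "u \<notin> written_regs c" "u \<noteq> i" "u \<noteq> 1" "i \<noteq> 1"
    and K: "K \<le> 4 * n + 1" "regs s u = real K"
    and insens: "\<And>m s x y. Inv m s \<Longrightarrow> Inv m (s\<lparr>regs := (regs s)(1 := x, i := y)\<rparr>)"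
    and init: "Inv 0 s"
    and body: "\<And>m s. m < K \<Longrightarrow> regs s u = real K \<Longrightarrow> regs s i = real m \<Longrightarrow> Inv m s \<Longrightarrow>
      achieves n c s (Inv (Suc m))"
    and final: "\<And>s. Inv K s \<Longrightarrow> Q s"
  shows "achieves n (For i u c) s Q"
proof -
  let ?B = "poly (cost c) n"
  let ?R = "insert 1 (insert i (written_regs c))"
  let ?inc = "Seq (Do (Const 1 1)) (Do (Arith Plus i i 1))"
  let ?body = "Seq (compile c) ?inc"
  let ?W = "WhileLess i u ?body"
  \<comment> \<open>Six extra steps per round: one loop test, three for the increment, and two for
    discarding a finished \<open>Skip\<close>. The last 1 is the failing test.\<close>
  have loop: "\<exists>t s'. t \<le> l * (?B + 6) + 1 \<and> runs ?W s t Skip s' \<and>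
      frame ?R (written_arrs c) s s' \<and> Inv K s'"
    if "l + m = K" "regs s u = real K" "regs s i = real m" "Inv m s" for l m s
    using that
  proof (induction l arbitrary: m s)
    case 0
    then have "\<not> regs s i < regs s u" by simp
    from step.While_False[OF this] 0 show ?case
      by (intro exI[of _ 1] exI[of _ s]) (auto simp: frame_refl)
  next
    case (Suc l)
    then have m: "m < K" by simp
    from body[OF m Suc.prems(2-4)] obtain t s1 where 1: "t \<le> ?B" "runs (compile c) s t Skip s1"
      "frame (written_regs c) (written_arrs c) s s1" "Inv (Suc m) s1"
      unfolding achieves_def by blast
    define s2 where "s2 = s1\<lparr>regs := (regs s1)(1 := 1, i := regs s1 i + 1)\<rparr>"
    have i: "regs s1 i = real m" "regs s1 u = real K"
      using frame_regs[OF 1(3)] wf Suc.prems by auto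
    have "runs (Do (Arith Plus i i 1)) (s1\<lparr>regs := (regs s1)(1 := 1)\<rparr>) 1 Skip s2"
      using wf by (intro runs_Do) (simp add: s2_def)
    from runs_Seq[OF runs_Do[of "Const 1 1" s1] this]
    have inc: "runs ?inc s1 3 Skip s2" by (simp add: eval_nat_numeral)
    have fr: "frame ?R (written_arrs c) s s2"
      using 1(3) by (auto simp: frame_def s2_def)
    have "Inv (Suc m) s2" unfolding s2_def by (rule insens) (rule 1(4))
    then obtain t' s' where 2: "t' \<le> l * (?B + 6) + 1" "runs ?W s2 t' Skip s'"
      "frame ?R (written_arrs c) s2 s'" "Inv K s'"
      using Suc.IH[of "Suc m" s2] Suc.prems i wf by (auto simp: s2_def)
    have lt: "regs s i < regs s u" using Suc.prems m by simp
    have r: "runs ?W s (Suc ((t + 3 + 1) + t' + 1)) Skip s'"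
      by (rule runs_step[OF step.While_True[OF lt] runs_Seq[OF runs_Seq[OF 1(2) inc] 2(2)]])
    show ?case
      using r 1(1) 2(1,4) frame_trans[OF fr 2(3) order_refl order_refl order_refl order_refl]
      by (intro exI[of _ "Suc ((t + 3 + 1) + t' + 1)"] exI[of _ s']) auto
  qed
  define s1 where "s1 = s\<lparr>regs := (regs s)(i := 0)\<rparr>"
  \<comment> \<open>Writing the old value back to register 1 brings the initialization into the form
    required by \<open>insens\<close>.\<close>
  have eq: "s1 = s\<lparr>regs := (regs s)(1 := regs s 1, i := 0)\<rparr>" by (simp add: s1_def)
  have "Inv 0 s1" unfolding eq by (rule insens) (rule init)
  then obtain t s' where 1: "t \<le> K * (?B + 6) + 1" "runs ?W s1 t Skip s'"
      "frame ?R (written_arrs c) s1 s'" "Inv K s'"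
    using loop[of K 0 s1] wf K by (auto simp: s1_def)
  have "runs (Do (Const i 0)) s 1 Skip s1" by (intro runs_Do) (simp add: s1_def)
  note r = runs_Seq[OF this 1(2)]
  have fr: "frame ?R (written_arrs c) s s1" by (auto simp: frame_def s1_def)
  have "K * (?B + 6) \<le> (4 * n + 1) * (?B + 6)" using K by (intro mult_right_mono) auto
  then have "1 + t + 1 \<le> poly (cost (For i u c)) n" using 1(1) by (simp add: algebra_simps)
  then show ?thesis unfolding achieves_def
    using r frame_trans[OF fr 1(3) order_refl order_refl order_refl order_refl] final[OF 1(4)]
    by (intro exI[of _ "1 + t + 1"] exI[of _ s']) auto
qed

section \<open>Space bound for programs without multiplication\<close>

text \<open>Multiplication is excluded because repeated squaring doubles the length of a number at
  each step. \<open>C\<close> bounds the binary length of the constants in the program text.\<close>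

fun additive_instr :: "nat \<Rightarrow> instr \<Rightarrow> bool" where
  "additive_instr C (Const _ z) \<longleftrightarrow> \<bar>z\<bar> \<le> 2 ^ C"
| "additive_instr C (Arith f _ _ _) \<longleftrightarrow> f = Plus \<or> f = Minus"
| "additive_instr C _ \<longleftrightarrow> True"

fun additive :: "nat \<Rightarrow> program \<Rightarrow> bool" where
  "additive C Skip \<longleftrightarrow> True"
| "additive C (Do i) \<longleftrightarrow> additive_instr C i"
| "additive C (Seq P Q) \<longleftrightarrow> additive C P \<and> additive C Q"
| "additive C (IfLe u v P Q) \<longleftrightarrow> additive C P \<and> additive C Q"
| "additive C (WhileLess u v P) \<longleftrightarrow> additive C P"

lemma additive_step: "step (P, s) (P', s') \<Longrightarrow> additive C P \<Longrightarrow> additive C P'"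
  by (induction "(P, s)" "(P', s')" arbitrary: P P' rule: step.induct) auto

lemma step_exec: "step (P, s) (P', s') \<Longrightarrow> additive C P \<Longrightarrow>
    s' = s \<or> (\<exists>i. additive_instr C i \<and> exec i s = Some s')"
  by (induction "(P, s)" "(P', s')" arbitrary: P P' rule: step.induct) auto

text \<open>
  All numbers are multiples of \<open>1 / D\<close> of absolute value at most \<open>2\<^sup>E\<close>: one addition
  increases \<open>E\<close> by one, whereas \<open>D\<close> stays fixed.
\<close>

definition small :: "nat \<Rightarrow> nat \<Rightarrow> real \<Rightarrow> bool" where
  "small D E v \<longleftrightarrow> real D * v \<in> \<int> \<and> \<bar>v\<bar> \<le> 2 ^ E"

text \<open>\<open>m\<close> and \<open>l\<close> count nonzero registers and nonzero cells.
  Addresses are bounded too, because \<open>state_size\<close> charges for them.\<close>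

definition small_state :: "nat \<Rightarrow> nat \<Rightarrow> nat \<Rightarrow> nat \<Rightarrow> machine_state \<Rightarrow> bool" where
  "small_state D E m l s \<longleftrightarrow>
     (\<forall>r. small D E (regs s r)) \<and> (\<forall>a i. small D E (arrs s a i)) \<and>
     finite {r. regs s r \<noteq> 0} \<and> card {r. regs s r \<noteq> 0} \<le> m \<and>
     finite {(a, i). arrs s a i \<noteq> 0} \<and> card {(a, i). arrs s a i \<noteq> 0} \<le> l \<and>
     (\<forall>a i. arrs s a i \<noteq> 0 \<longrightarrow> i \<le> 2 ^ E)"

lemma small_mono: "small D E v \<Longrightarrow> E \<le> E' \<Longrightarrow> small D E' v"
  unfolding small_def by (meson one_le_numeral order_trans power_increasing)

lemma small_add: "small D E u \<Longrightarrow> small D E v \<Longrightarrow> small D (Suc E) (u + v)"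
  and small_diff: "small D E u \<Longrightarrow> small D E v \<Longrightarrow> small D (Suc E) (u - v)"
  unfolding small_def by (auto simp: ring_distribs)

lemma small_0: "small D E 0" by (simp add: small_def)

lemma small_state_mono:
  assumes "small_state D E m l s" "E \<le> E'" "m \<le> m'" "l \<le> l'"
  shows "small_state D E' m' l' s"
proof -
  have "(2::nat) ^ E \<le> 2 ^ E'" using assms(2) by (simp add: power_increasing)
  with assms show ?thesis unfolding small_state_def by (meson small_mono order_trans)
qed

lemma small_state_set_reg:
  assumes "small_state D E m l s" "small D (Suc E) v"
  shows "small_state D (Suc E) (Suc m) l (s\<lparr>regs := (regs s)(r := v)\<rparr>)"
proof -
  have s: "small_state D (Suc E) m l s" by (rule small_state_mono[OF assms(1)]) auto
  have sub: "{q. ((regs s)(r := v)) q \<noteq> 0} \<subseteq> insert r {q. regs s q \<noteq> 0}" by auto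
  have fin: "finite {q. regs s q \<noteq> 0}" and "card {q. regs s q \<noteq> 0} \<le> m"
    using s by (auto simp: small_state_def)
  then have "card (insert r {q. regs s q \<noteq> 0}) \<le> Suc m" by (simp add: card_insert_if)
  then have "card {q. ((regs s)(r := v)) q \<noteq> 0} \<le> Suc m"
    using card_mono[OF _ sub] fin by simp
  moreover have "finite {q. ((regs s)(r := v)) q \<noteq> 0}" using finite_subset[OF sub] fin by simp
  ultimately show ?thesis using s assms(2) unfolding small_state_def by auto
qed

lemma small_state_set_arr:
  assumes "small_state D E m l s" "small D (Suc E) v" "i \<le> 2 ^ Suc E"
  shows "small_state D (Suc E) m (Suc l) (s\<lparr>arrs := (arrs s)(a := (arrs s a)(i := v))\<rparr>)"
proof -
  have s: "small_state D (Suc E) m l s" by (rule small_state_mono[OF assms(1)]) auto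
  let ?f = "(arrs s)(a := (arrs s a)(i := v))"
  have sub: "{(a, i). ?f a i \<noteq> 0} \<subseteq> insert (a, i) {(a, i). arrs s a i \<noteq> 0}"
    by (auto split: if_splits)
  have fin: "finite {(a, i). arrs s a i \<noteq> 0}" and "card {(a, i). arrs s a i \<noteq> 0} \<le> l"
    using s by (auto simp: small_state_def)
  then have "card (insert (a, i) {(a, i). arrs s a i \<noteq> 0}) \<le> Suc l"
    by (simp add: card_insert_if)
  then have "card {(a, i). ?f a i \<noteq> 0} \<le> Suc l" using card_mono[OF _ sub] fin by simp
  moreover have "finite {(a, i). ?f a i \<noteq> 0}" using finite_subset[OF sub] fin by simp
  ultimately show ?thesis using s assms(2,3) unfolding small_state_def by auto
qed

text \<open>One instruction adds at most one bit and at most one nonzero register or cell. The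
  address of a \<open>Store\<close> is the value of a register and hence obeys the bound for
  numbers; \<open>C \<le> E\<close> makes the constants fit.\<close>

lemma small_state_exec:
  assumes s: "small_state D E m l s" and i: "additive_instr C i" "C \<le> E" and "exec i s = Some s'"
  shows "small_state D (Suc E) (Suc m) (Suc l) s'"
proof -
  have r: "small D E (regs s r)" "small D (Suc E) (regs s r)" for r
    using s small_mono[of D E _ "Suc E"] by (auto simp: small_state_def)
  have a: "small D (Suc E) (arrs s b q)" for b q
    using s small_mono[of D E _ "Suc E"] by (auto simp: small_state_def)
  have reg: "small_state D (Suc E) (Suc m) (Suc l) (s\<lparr>regs := (regs s)(q := v)\<rparr>)"
    if "small D (Suc E) v" for q v
    by (rule small_state_mono[OF small_state_set_reg[OF s that]]) auto
  show ?thesis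
  proof (cases i)
    case (Const q z)
    have "real_of_int \<bar>z\<bar> \<le> of_int (2 ^ C)" using i Const by (simp del: of_int_abs)
    also have "\<dots> \<le> 2 ^ Suc E" using i power_increasing[of C "Suc E" "2::real"] by simp
    finally have "small D (Suc E) (of_int z)" by (simp add: small_def)
    with Const assms(4) reg show ?thesis by auto
  next
    case (Arith f q u v)
    then show ?thesis
      using assms(4) i reg[OF small_add[OF r(1) r(1)]] reg[OF small_diff[OF r(1) r(1)]] by auto
  next
    case (Store b u q)
    then have N: "regs s u \<in> \<nat>"
      and s': "s' = s\<lparr>arrs := (arrs s)(b := (arrs s b)(nat \<lfloor>regs s u\<rfloor> := regs s q))\<rparr>"
      using assms(4) by (auto split: if_splits)
    from N obtain w where w: "regs s u = real w" by (auto elim: Nats_cases)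
    then have "real w \<le> real (2 ^ E)" using r(1)[of u] by (simp add: small_def)
    then have "w \<le> 2 ^ E" by (simp only: of_nat_le_iff)
    then have "nat \<lfloor>regs s u\<rfloor> \<le> 2 ^ Suc E" using w by simp
    from small_state_mono[OF small_state_set_arr[OF s r(2) this]] show ?thesis by (simp add: s')
  qed (use assms(4) reg r a in \<open>auto split: if_splits\<close>)
qed

lemma small_state_runs:
  assumes "small_state D E m l s" "additive C P" "C \<le> E" "runs P s t P' s'"
  shows "additive C P' \<and> small_state D (E + t) (m + t) (l + t) s'"
  using assms(4)
proof (induction t arbitrary: P' s')
  case (Suc t)
  then obtain P1 s1 where 1: "runs P s t P1 s1" "step (P1, s1) (P', s')" by auto
  note IH = Suc.IH[OF 1(1)]
  have "small_state D (Suc (E + t)) (Suc (m + t)) (Suc (l + t)) s'"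
    using step_exec[OF 1(2)] IH small_state_exec[of D "E + t" "m + t" "l + t" s1 C] assms(3)
      small_state_mono[of D "E + t" "m + t" "l + t" s1] by (metis le_SucI order_refl trans_le_add1)
  with additive_step[OF 1(2)] IH show ?case by simp
qed (use assms in auto)

section \<open>Encoding lengths of rational numbers and of states\<close>

lemma floorlog_le: "x \<le> 2 ^ E \<Longrightarrow> floorlog 2 x \<le> Suc E"
  by (rule floorlog_leI) (auto intro: le_less_trans)

lemma number_size_of_rat: "number_size (real_of_rat q) =
    1 + floorlog 2 (nat \<bar>fst (quotient_of q)\<bar>) + floorlog 2 (nat (snd (quotient_of q)))"
proof -
  have "inj real_of_rat" by (auto intro: injI)
  then show ?thesis by (simp add: number_size_def the_inv_f_f Let_def split: prod.splits)
qed

text \<open>The denominator in lowest terms divides \<open>D\<close> and so has at most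
  \<open>S + 1\<close> digits. The numerator is the value times this denominator and has at most
  \<open>E + S + 1\<close> digits. The sign accounts for the rest.\<close>

lemma number_size_le:
  assumes v: "small D E v" and D: "0 < D" "D \<le> 2 ^ S"
  shows "number_size v \<le> E + 2 * S + 3"
proof -
  from v obtain p where p: "real D * v = of_int p" by (auto simp: small_def elim: Ints_cases)
  then have "v = real_of_rat (of_int p / of_nat D)" using D
    by (simp add: of_rat_divide field_simps)
  moreover obtain a b where q: "quotient_of (of_int p / of_nat D) = (a, b)" by fastforce
  ultimately have size: "number_size v = 1 + floorlog 2 (nat \<bar>a\<bar>) + floorlog 2 (nat b)"
    using number_size_of_rat by simp
  have b: "0 < b" "coprime a b" using quotient_of_denom_pos[OF q] quotient_of_coprime[OF q] by auto
  have "(of_int p / of_nat D :: rat) = of_int a / of_int b" by (rule quotient_of_div[OF q])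
  then have "(of_int (p * b) :: rat) = of_int (a * int D)"
    using b D by (simp add: field_simps)
  then have eq: "p * b = a * int D" by (simp only: of_int_eq_iff)
  then have "b dvd a * int D" by (metis dvd_triv_right)
  then have "b dvd int D" using b(2) by (simp add: coprime_commute coprime_dvd_mult_right_iff)
  then have bD: "b \<le> int D" using D zdvd_imp_le by auto
  have "real_of_int (\<bar>a\<bar> * int D) = \<bar>v\<bar> * real D * real_of_int b"
  proof -
    have "real_of_int (\<bar>a\<bar> * int D) = \<bar>real_of_int (a * int D)\<bar>" by (simp add: abs_mult)
    also have "\<dots> = \<bar>real_of_int (p * b)\<bar>" by (simp add: eq)
    also have "\<dots> = \<bar>real D * v\<bar> * real_of_int b" using b p by (simp add: abs_mult)
    finally show ?thesis by (simp add: abs_mult mult_ac)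
  qed
  also have "\<dots> \<le> 2 ^ E * real D * 2 ^ S"
  proof (intro mult_mono)
    have "real_of_int b \<le> real D" using bD by linarith
    also have "\<dots> \<le> real (2 ^ S)" using D(2) by (simp only: of_nat_le_iff)
    finally show "real_of_int b \<le> 2 ^ S" by simp
  qed (use v b in \<open>auto simp: small_def\<close>)
  finally have "real_of_int \<bar>a\<bar> \<le> 2 ^ (E + S)"
    using D by (simp add: power_add field_simps)
  then have "real (nat \<bar>a\<bar>) \<le> real (2 ^ (E + S))" by simp
  then have "nat \<bar>a\<bar> \<le> 2 ^ (E + S)" by (simp only: of_nat_le_iff)
  moreover have "nat b \<le> 2 ^ S" using bD D by linarith
  ultimately show ?thesis
    using floorlog_le[of "nat \<bar>a\<bar>" "E + S"] floorlog_le[of "nat b" S] size by simp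
qed

lemma state_size_le:
  assumes s: "small_state D E m l s" and D: "0 < D" "D \<le> 2 ^ S"
  shows "state_size s \<le> m * (E + 2 * S + 3) + l * (2 * E + 2 * S + 4)"
proof -
  have n: "number_size v \<le> E + 2 * S + 3" if "small D E v" for v
    by (rule number_size_le[OF that D])
  have "(\<Sum>r | regs s r \<noteq> 0. number_size (regs s r)) \<le> card {r. regs s r \<noteq> 0} * (E + 2 * S + 3)"
    using sum_bounded_above[of "{r. regs s r \<noteq> 0}" "\<lambda>r. number_size (regs s r)" "E + 2 * S + 3"]
      n s by (simp add: small_state_def)
  also have "\<dots> \<le> m * (E + 2 * S + 3)" using s by (intro mult_right_mono) (auto simp: small_state_def)
  finally have 1: "(\<Sum>r | regs s r \<noteq> 0. number_size (regs s r)) \<le> m * (E + 2 * S + 3)" .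
  have "floorlog 2 i + number_size (arrs s a i) \<le> 2 * E + 2 * S + 4" if "arrs s a i \<noteq> 0" for a i
    using n[of "arrs s a i"] floorlog_le[of i E] s that by (auto simp: small_state_def)
  then have "(\<Sum>(a, i)\<in>{(a, i). arrs s a i \<noteq> 0}. floorlog 2 i + number_size (arrs s a i))
      \<le> card {(a, i). arrs s a i \<noteq> 0} * (2 * E + 2 * S + 4)"
    using sum_bounded_above[of "{(a, i). arrs s a i \<noteq> 0}"
      "\<lambda>(a, i). floorlog 2 i + number_size (arrs s a i)" "2 * E + 2 * S + 4"] by auto
  also have "\<dots> \<le> l * (2 * E + 2 * S + 4)"
    using s by (intro mult_right_mono) (auto simp: small_state_def)
  finally show ?thesis using 1 by (simp add: state_size_def)
qed

lemma le_two_power: "(n::nat) \<le> 2 ^ n"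
  by (simp add: less_imp_le)

lemma number_size_pos: "1 \<le> number_size v"
  by (simp add: number_size_def split: prod.splits)

lemma rational_small:
  assumes "v \<in> \<rat>"
  shows "\<exists>b>0. real b * v \<in> \<int> \<and> b \<le> 2 ^ number_size v \<and> \<bar>v\<bar> \<le> 2 ^ number_size v"
proof -
  obtain q where q: "v = real_of_rat q" using assms by (auto simp: Rats_def)
  obtain a b where ab: "quotient_of q = (a, b)" by fastforce
  have b: "0 < b" using quotient_of_denom_pos[OF ab] .
  have v: "v = real_of_int a / real_of_int b" using quotient_of_div[OF ab] q
    by (simp add: of_rat_divide)
  have size: "number_size v = 1 + floorlog 2 (nat \<bar>a\<bar>) + floorlog 2 (nat b)"
    using number_size_of_rat q ab by simp
  have le: "x \<le> 2 ^ floorlog 2 x" for x :: nat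
    using floorlog_bounds[of x 2] by (cases "x = 0") auto
  have pw: "(2::nat) ^ floorlog 2 (nat b) \<le> 2 ^ number_size v"
      "(2::nat) ^ floorlog 2 (nat \<bar>a\<bar>) \<le> 2 ^ number_size v"
    by (rule power_increasing, simp add: size, simp)+
  have "nat b \<le> 2 ^ number_size v" using le[of "nat b"] pw by linarith
  moreover have "nat \<bar>a\<bar> \<le> 2 ^ number_size v" using le[of "nat \<bar>a\<bar>"] pw by linarith
  then have "real (nat \<bar>a\<bar>) \<le> real (2 ^ number_size v)" by (simp only: of_nat_le_iff)
  then have "\<bar>real_of_int a\<bar> \<le> 2 ^ number_size v" by simp
  moreover have "\<bar>v\<bar> \<le> \<bar>real_of_int a\<bar>"
  proof -
    have "1 \<le> real_of_int b" using b by simp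
    then have "\<bar>real_of_int a\<bar> / real_of_int b \<le> \<bar>real_of_int a\<bar> / 1"
      by (intro divide_left_mono) auto
    then show ?thesis using b by (simp add: v abs_divide)
  qed
  ultimately show ?thesis using b v by (intro exI[of _ "nat b"]) auto
qed

text \<open>The product of all denominators serves as \<open>D\<close>; its length is at most the
  sum of the sizes because each denominator is at most 2 to the size of its number.\<close>

lemma common_denominator:
  assumes "set xs \<subseteq> \<rat>"
  shows "\<exists>D>0. D \<le> 2 ^ (\<Sum>x\<leftarrow>xs. number_size x) \<and>
    (\<forall>x\<in>set xs. small D (\<Sum>x\<leftarrow>xs. number_size x) x)"
  using assms
proof (induction xs)
  case (Cons x xs)
  let ?S = "\<Sum>x\<leftarrow>xs. number_size x"
  obtain D where D: "0 < D" "D \<le> 2 ^ ?S" "\<And>x. x \<in> set xs \<Longrightarrow> small D ?S x"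
    using Cons by auto
  obtain b where b: "0 < b" "real b * x \<in> \<int>" "b \<le> 2 ^ number_size x" "\<bar>x\<bar> \<le> 2 ^ number_size x"
    using rational_small[of x] Cons.prems by auto
  have m: "small (b * D) E y" if "small D E y" for y E
    using that Ints_mult[OF Ints_of_nat[of b], of "real D * y"] by (auto simp: small_def mult_ac)
  have "real D * (real b * x) \<in> \<int>" using b(2) by (rule Ints_mult[OF Ints_of_nat])
  then have "small (b * D) (number_size x) x" using b(4) by (simp add: small_def mult_ac)
  then have "small (b * D) (number_size x + ?S) y" if "y \<in> set (x # xs)" for y
    using that m[OF D(3)] small_mono[of _ ?S y "number_size x + ?S"] small_mono[of _ "number_size x"] by fastforce
  moreover have "b * D \<le> 2 ^ (number_size x + ?S)"
    using mult_mono[OF b(3) D(2)] by (simp add: power_add)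
  ultimately show ?case using b(1) D(1) by (intro exI[of _ "b * D"]) auto
qed auto

lemma length_le_sum_number_size: "length xs \<le> (\<Sum>x\<leftarrow>xs. number_size x)"
proof (induction xs)
  case (Cons x xs)
  then show ?case using number_size_pos[of x] by simp
qed simp

lemma nonzero_initial:
  "{(a, i). arrs (initial_state inp) a i \<noteq> 0} \<subseteq> (SIGMA a:{..<length inp}. {..<length (inp ! a)})"
  by (auto simp: initial_state_def split: if_splits)

lemma card_cells: "card (SIGMA a:{..<length inp}. {..<length (inp ! a)}) = length (concat inp)"
  by (simp add: length_concat sum_list_sum_nth atLeast0LessThan)

lemma initial_small:
  assumes "set (concat inp) \<subseteq> \<rat>"
  shows "\<exists>D>0. D \<le> 2 ^ input_size inp \<and>
    small_state D (input_size inp) 0 (input_size inp) (initial_state inp)"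
proof -
  let ?S = "input_size inp" and ?s = "initial_state inp"
  let ?Z = "SIGMA a:{..<length inp}. {..<length (inp ! a)}"
  obtain D where D: "0 < D" "D \<le> 2 ^ ?S" "\<And>x. x \<in> set (concat inp) \<Longrightarrow> small D ?S x"
    using common_denominator[OF assms] unfolding input_size_def by auto
  have Z: "finite ?Z" by simp
  have len: "length (concat inp) \<le> ?S"
    unfolding input_size_def by (rule length_le_sum_number_size)
  have card: "card {(a, i). arrs ?s a i \<noteq> 0} \<le> ?S"
    using card_mono[OF Z nonzero_initial] card_cells len by (metis order_trans)
  have fin: "finite {(a, i). arrs ?s a i \<noteq> 0}"
    by (rule finite_subset[OF nonzero_initial Z])
  have sm: "small D ?S (arrs ?s a i)" for a i
    proof (cases "a < length inp \<and> i < length (inp ! a)")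
    case True
    then have "inp ! a ! i \<in> set (concat inp)" by (metis UN_I nth_mem set_concat)
    then show ?thesis using D(3) True by (simp add: initial_state_def)
  qed (auto simp: initial_state_def small_0)
  \<comment> \<open>A position is smaller than the number of input entries, and each entry
    contributes at least 1 to the input size.\<close>
  have addr: "i \<le> 2 ^ ?S" if "arrs ?s a i \<noteq> 0" for a i
  proof -
    have "a < length inp" "i < length (inp ! a)"
      using that by (auto simp: initial_state_def split: if_splits)
    then have "{a} \<times> {..<length (inp ! a)} \<subseteq> ?Z" by auto
    from card_mono[OF Z this] have "length (inp ! a) \<le> length (concat inp)"
      by (simp only: card_cells) simp
    with \<open>i < length (inp ! a)\<close> len le_two_power[of ?S] show ?thesis by linarith
  qed
  show ?thesis
    using D(1,2) card fin sm addr
    by (intro exI[of _ D]) (auto simp: small_state_def initial_state_def small_0)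
qed

lemma poly_nat_mono: "(m::nat) \<le> n \<Longrightarrow> poly p m \<le> poly p n"
  by (induction p) (auto intro: add_mono mult_mono)

text \<open>By determinism every run is a prefix of the terminating one. The space bound speaks of
  all reachable configurations, and this confines them to the steps already counted.\<close>

lemma runs_final:
  assumes "runs P s t Skip s'" "runs P s u P1 s1"
  shows "u \<le> t"
  using assms
proof (induction t arbitrary: P s u)
  case 0
  then show ?case
  proof (cases u)
    case (Suc v)
    then obtain c where "step (Skip, s') c" using 0 relpowp_Suc_D2[where P = step and n = v] by fastforce
    then show ?thesis by (cases rule: step.cases)
  qed simp
next
  case (Suc t)
  show ?case
  proof (cases u)
    case (Suc v)
    obtain P2 s2 where 2: "step (P, s) (P2, s2)" "runs P2 s2 t Skip s'"
      using relpowp_Suc_D2[OF Suc.prems(1)] by auto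
    obtain P3 s3 where 3: "step (P, s) (P3, s3)" "runs P3 s3 v P1 s1"
      using relpowp_Suc_D2[where P = step and n = v] Suc.prems(2) \<open>u = Suc v\<close> by (metis surj_pair)
    have "(P3, s3) = (P2, s2)" using step_deterministic 2 3 by blast
    then show ?thesis using Suc.IH[OF 2(2), of v] 3 Suc by auto
  qed simp
qed

text \<open>In polynomially many steps an additive program lengthens numbers by polynomially many
  bits and touches polynomially many places. \<open>dim\<close> converts the time bound in the
  dimension into one in the input size.\<close>

theorem additive_strongly_polynomial:
  fixes T :: "nat poly"
  assumes add: "additive C P"
    and run: "\<And>I. I \<in> Inst \<Longrightarrow> \<exists>t s. t \<le> poly T (dimension I) \<and>
       runs P (initial_state (enc I)) t Skip s \<and> regs s 0 = f I"
    and dim: "\<And>I. I \<in> Inst \<Longrightarrow> dimension I \<le> input_size (enc I)"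
  shows "strongly_polynomial_time Inst dimension enc f"
proof -
  define X :: "nat poly" where "X = [:0, 1:]"
  \<comment> \<open>The bound of \<open>state_size_le\<close> with \<open>E = X + C + T\<close>,
    \<open>m = T\<close>, \<open>l = X + T\<close> and \<open>S = X\<close>, where \<open>X\<close>
    stands for the input size.\<close>
  define Sp where "Sp = T * (X + [:C:] + T + 2 * X + 3) + (X + T) * (2 * (X + [:C:] + T) + 2 * X + 4)"
  have "state_size s \<le> poly Sp (input_size (enc I))"
    if I: "I \<in> Inst" and rat: "set (concat (enc I)) \<subseteq> \<rat>"
      and reach: "step\<^sup>*\<^sup>* (P, initial_state (enc I)) (P', s)" for I P' s
  proof -
    let ?S = "input_size (enc I)" and ?s0 = "initial_state (enc I)"
    obtain t s1 where t: "t \<le> poly T (dimension I)" "runs P ?s0 t Skip s1"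
      using run[OF I] by blast
    obtain u where u: "runs P ?s0 u P' s" using reach by (meson rtranclp_imp_relpowp)
    have "u \<le> t" by (rule runs_final[OF t(2) u])
    also have "\<dots> \<le> poly T ?S" using t(1) poly_nat_mono[OF dim[OF I]] by (meson order_trans)
    finally have uT: "u \<le> poly T ?S" .
    obtain D where D: "0 < D" "D \<le> 2 ^ ?S" "small_state D ?S 0 ?S ?s0"
      using initial_small[OF rat] by blast
    \<comment> \<open>Raising the exponent by \<open>C\<close> makes room for the constants of the
      program.\<close>
    have "small_state D (?S + C) 0 ?S ?s0" by (rule small_state_mono[OF D(3)]) auto
    from small_state_runs[OF this add _ u]
    have "small_state D (?S + C + u) (0 + u) (?S + u) s" by simp
    from small_state_mono[OF this, of "?S + C + poly T ?S" "poly T ?S" "?S + poly T ?S"] uT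
    have "small_state D (?S + C + poly T ?S) (poly T ?S) (?S + poly T ?S) s" by simp
    from state_size_le[OF this D(1,2)] show ?thesis
      by (simp add: Sp_def X_def algebra_simps)
  qed
  with run show ?thesis unfolding strongly_polynomial_time_def by blast
qed

section \<open>The dual of the recovery problem\<close>

text \<open>
  The set \<open>A\<close> is the first-stage solution, and \<open>L i\<close> identifies the part of item \<open>i\<close>.
  For 0/1 vectors in the same parts, the condition on \<open>card (B - A)\<close> is the distance bound.
\<close>

definition recoveries :: "nat set \<Rightarrow> (nat \<Rightarrow> 'b) \<Rightarrow> nat set \<Rightarrow> nat \<Rightarrow> nat set set" where
  "recoveries N L A k = {B. B \<subseteq> N \<and> (\<forall>r\<in>N. card {i\<in>B. L i = L r} = card {i\<in>A. L i = L r}) \<and>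
     card (B - A) \<le> k}"

text \<open>
  The multiplier \<open>lam\<close> belongs to the distance bound and \<open>mu\<close> to the part containing the
  item, whose cost is \<open>v\<close>.
\<close>

definition contribution :: "bool \<Rightarrow> real \<Rightarrow> real \<Rightarrow> real \<Rightarrow> real" where
  "contribution a lam mu v =
     (if a then mu else 0) - max 0 (mu - (v + (if a then 0 else lam)))"

text \<open>The dual objective except for the term of the distance bound. In the linear program a
  part contributes its demand times its multiplier; the demand is the number of items of
  \<open>A\<close> in the part, so the term is spread over these items. The objective becomes a sum
  over single items, as the dynamic program requires.\<close>

definition dual_sum ::
  "nat set \<Rightarrow> (nat \<Rightarrow> nat) \<Rightarrow> nat set \<Rightarrow> real \<Rightarrow> (nat \<Rightarrow> real) \<Rightarrow> (nat \<Rightarrow> real) \<Rightarrow> real" where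
  "dual_sum S L A lam mu v = (\<Sum>i\<in>S. contribution (i \<in> A) lam (mu (L i)) (v i))"

lemma sum_parts:
  assumes "finite N" "B \<subseteq> N"
  shows "(\<Sum>i\<in>B. mu (L i)) = (\<Sum>l\<in>L ` N. real (card {i\<in>B. L i = l}) * mu l)"
proof -
  have "(\<Sum>i\<in>B. mu (L i)) = (\<Sum>l\<in>L ` N. \<Sum>i\<in>{i\<in>B. L i = l}. mu (L i))"
    using assms by (intro sum.group[symmetric]) (auto intro: finite_subset)
  also have "\<dots> = (\<Sum>l\<in>L ` N. real (card {i\<in>B. L i = l}) * mu l)" by (intro sum.cong) auto
  finally show ?thesis .
qed

text \<open>\<open>A\<close> and \<open>B\<close> have equally many items in each part, so weights
  that depend only on the part cannot tell them apart. Constant weight 1 yields equal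
  cardinality.\<close>

lemma sum_parts_recovery:
  fixes mu :: "'b \<Rightarrow> real"
  assumes "finite N" "A \<subseteq> N" "B \<in> recoveries N L A k"
  shows "(\<Sum>i\<in>B. mu (L i)) = (\<Sum>i\<in>A. mu (L i))"
proof -
  have "B \<subseteq> N" using assms(3) by (simp add: recoveries_def)
  moreover have "(\<Sum>l\<in>L ` N. real (card {i\<in>B. L i = l}) * mu l) =
      (\<Sum>l\<in>L ` N. real (card {i\<in>A. L i = l}) * mu l)"
    using assms(3) by (intro sum.cong) (auto simp: recoveries_def)
  ultimately show ?thesis using assms(1,2) by (simp add: sum_parts)
qed

lemma dual_sum_eq:
  assumes "finite N" "A \<subseteq> N" "B \<in> recoveries N L A k"
  shows "dual_sum N L A lam mu v =
    (\<Sum>i\<in>B. mu (L i)) - (\<Sum>i\<in>N. max 0 (mu (L i) - (v i + (if i \<in> A then 0 else lam))))"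
proof -
  have "(\<Sum>i\<in>N. if i \<in> A then mu (L i) else 0) = (\<Sum>i\<in>A. mu (L i))"
    using assms by (simp add: sum.inter_restrict[symmetric] Int_absorb1)
  then show ?thesis unfolding dual_sum_def contribution_def
    by (simp add: sum_subtractf sum_parts_recovery[OF assms])
qed

lemma sum_penalized:
  assumes "finite B"
  shows "(\<Sum>i\<in>B. v i + (if i \<in> A then 0 else lam)) = sum v B + real (card (B - A)) * (lam :: real)"
proof -
  have "(\<Sum>i\<in>B. if i \<in> A then 0 else lam) = (\<Sum>i\<in>B - A. lam)"
    using assms by (intro sum.mono_neutral_cong_right) auto
  then show ?thesis by (simp add: sum.distrib)
qed

text \<open>On \<open>B\<close> the terms \<open>mu - ct\<close> are at most their positive parts,
  and extending the sum of positive parts to \<open>N\<close> only increases it. Since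
  \<open>card (B - A)\<close> never exceeds \<open>card N\<close>, the distance bound may be capped,
  which later limits the number of additions.\<close>

lemma weak_duality:
  assumes N: "finite N" "A \<subseteq> N" and B: "B \<in> recoveries N L A k" and lam: "0 \<le> lam"
  shows "dual_sum N L A lam mu v - real (min k (card N)) * lam \<le> sum v B"
proof -
  let ?ct = "\<lambda>i. v i + (if i \<in> A then 0 else lam)"
  have BN: "B \<subseteq> N" and fB: "finite B" using B N by (auto simp: recoveries_def intro: finite_subset)
  have "card (B - A) \<le> card N" using BN N by (intro card_mono) auto
  then have "card (B - A) \<le> min k (card N)" using B by (simp add: recoveries_def)
  then have "real (card (B - A)) \<le> real (min k (card N))" by (simp only: of_nat_le_iff)
  then have le: "real (card (B - A)) * lam \<le> real (min k (card N)) * lam"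
    using lam by (rule mult_right_mono)
  have "(\<Sum>i\<in>B. max 0 (mu (L i) - ?ct i)) \<le> (\<Sum>i\<in>N. max 0 (mu (L i) - ?ct i))"
    using N BN by (intro sum_mono2) auto
  moreover have "(\<Sum>i\<in>B. mu (L i) - ?ct i) \<le> (\<Sum>i\<in>B. max 0 (mu (L i) - ?ct i))"
    by (intro sum_mono) auto
  ultimately show ?thesis
    using le sum_penalized[OF fB, of v A lam] by (simp add: dual_sum_eq[OF N B] sum_subtractf)
qed

section \<open>Exchanging two items of the same part\<close>

definition swap :: "nat \<Rightarrow> nat \<Rightarrow> nat set \<Rightarrow> nat set" where
  "swap a b B = insert b (B - {a})"

lemma sum_swap:
  assumes "finite B" "a \<in> B" "b \<notin> B"
  shows "sum v (swap a b B) = sum v B - v a + (v b :: real)"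
  using assms by (simp add: swap_def sum_diff1)

lemma card_part_swap:
  assumes "finite B" "a \<in> B" "b \<notin> B" "L a = L b"
  shows "card {i\<in>swap a b B. L i = l} = card {i\<in>B. L i = l}"
proof (cases "L a = l")
  case True
  then have "{i\<in>swap a b B. L i = l} = insert b ({i\<in>B. L i = l} - {a})"
    using assms by (auto simp: swap_def)
  moreover have "Suc (card ({i\<in>B. L i = l} - {a})) = card {i\<in>B. L i = l}"
    using assms True by (intro card_Suc_Diff1) auto
  ultimately show ?thesis using assms by simp
next
  case False
  then have "{i\<in>swap a b B. L i = l} = {i\<in>B. L i = l}" using assms by (auto simp: swap_def)
  then show ?thesis by simp
qed

text \<open>Stated with additions on both sides to avoid truncated subtraction of natural
  numbers.\<close>

lemma card_swap_diff:
  assumes "finite B" "a \<in> B" "b \<notin> B"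
  shows "card (swap a b B - A) + of_bool (a \<notin> A) = card (B - A) + of_bool (b \<notin> A)"
proof -
  have "swap a b B - A = (if b \<in> A then B - A - {a} else insert b (B - A - {a}))"
    by (auto simp: swap_def)
  then have "card (swap a b B - A) = card (B - A - {a}) + of_bool (b \<notin> A)"
    using assms by simp
  moreover have "card (B - A - {a}) + of_bool (a \<notin> A) = card (B - A)"
  proof (cases "a \<in> A")
    case False
    then have "Suc (card (B - A - {a})) = card (B - A)"
      using assms by (intro card_Suc_Diff1) auto
    then show ?thesis using False by simp
  qed simp
  ultimately show ?thesis by simp
qed

text \<open>The two bounds \<open>k'\<close> and \<open>k\<close> may differ because the
  intermediate set of a double exchange can exceed the distance bound by one.\<close>

lemma swap_in_recoveries:
  assumes "finite N" "B \<in> recoveries N L A k'" "a \<in> B" "b \<in> N" "b \<notin> B" "L a = L b"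
    and "card (B - A) + of_bool (b \<notin> A) \<le> k + of_bool (a \<notin> A)"
  shows "swap a b B \<in> recoveries N L A k"
proof -
  have "finite B" using assms by (auto simp: recoveries_def intro: finite_subset)
  with assms show ?thesis
    using card_swap_diff[of B a b A] card_part_swap[of B a b L]
    by (auto simp: recoveries_def) (auto simp: swap_def)
qed

text \<open>
  The multiplier \<open>lam\<close> is the largest gain of a swap that moves an optimal recovery \<open>B\<close>
  further away from \<open>A\<close>. Combining such a swap with one that moves \<open>B\<close> back towards \<open>A\<close>
  preserves the distance, so by optimality \<open>B\<close> is cheapest in each part for the penalized costs.
\<close>

lemma optimal_penalty:
  fixes v :: "nat \<Rightarrow> real"
  assumes N: "finite N" "N \<noteq> {}" and A: "A \<subseteq> N" and B: "B \<in> recoveries N L A k"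
    and opt: "\<And>B'. B' \<in> recoveries N L A k \<Longrightarrow> sum v B \<le> sum v B'"
  shows "\<exists>s\<in>N. \<exists>t\<in>N. \<exists>lam. lam = max 0 (v s - v t) \<and> real (card (B - A)) * lam = real k * lam \<and>
    (\<forall>a\<in>B. \<forall>b\<in>N - B. L a = L b \<longrightarrow>
      v a + (if a \<in> A then 0 else lam) \<le> v b + (if b \<in> A then 0 else lam))"
proof -
  have BN: "B \<subseteq> N" and fB: "finite B" and hB: "card (B - A) \<le> k"
    using B N by (auto simp: recoveries_def intro: finite_subset)
  \<comment> \<open>The exchanges that move \<open>B\<close> away from \<open>A\<close>.\<close>
  define P where "P = {(a, b) \<in> N \<times> N. a \<in> A \<and> a \<in> B \<and> b \<notin> A \<and> b \<notin> B \<and> L a = L b}"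
  have P: "finite P" unfolding P_def by (rule finite_subset[of _ "N \<times> N"]) (use N in auto)
  \<comment> \<open>Inserting 0 keeps \<open>lam\<close> nonnegative and the maximum defined when
    \<open>P\<close> is empty.\<close>
  define lam where "lam = Max (insert 0 ((\<lambda>(a, b). v a - v b) ` P))"
  have fin: "finite (insert 0 ((\<lambda>(a, b). v a - v b) ` P))" using P by simp
  have lam_in: "lam \<in> insert 0 ((\<lambda>(a, b). v a - v b) ` P)"
    unfolding lam_def using fin by (intro Max_in) auto
  have lam0: "0 \<le> lam" unfolding lam_def using fin by (intro Max_ge) auto
  have lamP: "v a - v b \<le> lam" if "(a, b) \<in> P" for a b
    unfolding lam_def using fin that by (intro Max_ge) (auto intro!: rev_image_eqI)
  have single: "v a \<le> v b"
    if "a \<in> B" "b \<in> N" "b \<notin> B" "L a = L b"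
      "card (B - A) + of_bool (b \<notin> A) \<le> k + of_bool (a \<notin> A)" for a b
    using opt[OF swap_in_recoveries[OF N(1) B that]] sum_swap[OF fB that(1,3), of v] by simp
  have double: "v a + v a' \<le> v b + v b'"
    if "(a, b) \<in> P" and 2: "a' \<in> B" "a' \<notin> A" "b' \<in> N" "b' \<in> A" "b' \<notin> B" "L a' = L b'"
    for a b a' b'
  proof -
    have 1: "a \<in> B" "a \<in> A" "b \<in> N" "b \<notin> A" "b \<notin> B" "L a = L b"
      using that(1) by (auto simp: P_def)
    let ?B = "swap a b B"
    \<comment> \<open>The outward exchange alone may violate the bound by one; the inward exchange
      that follows repairs this.\<close>
    have B1: "?B \<in> recoveries N L A (Suc k)"
      using 1 hB by (intro swap_in_recoveries[OF N(1) B]) auto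
    have m: "a' \<in> ?B" "b' \<notin> ?B" using 1 2 by (auto simp: swap_def)
    have "card (?B - A) \<le> Suc k" using B1 by (simp add: recoveries_def)
    then have "swap a' b' ?B \<in> recoveries N L A k"
      using 2 m by (intro swap_in_recoveries[OF N(1) B1]) auto
    from opt[OF this] show ?thesis
      using sum_swap[of ?B a' b' v] sum_swap[OF fB 1(1,5), of v] m fB by (simp add: swap_def)
  qed
  \<comment> \<open>Complementary slackness: if the distance bound is not tight, an outward exchange
    is feasible by itself, and optimality forbids a positive gain.\<close>
  have slack: "real (card (B - A)) * lam = real k * lam"
  proof (cases "lam = 0")
    case False
    then obtain a b where ab: "(a, b) \<in> P" "lam = v a - v b" using lam_in by auto
    have "\<not> card (B - A) < k"
    proof
      assume "card (B - A) < k"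
      then have "v a \<le> v b" using ab(1) by (intro single) (auto simp: P_def)
      with ab(2) lam0 False show False by simp
    qed
    with hB show ?thesis by simp
  qed simp
  have order: "v a + (if a \<in> A then 0 else lam) \<le> v b + (if b \<in> A then 0 else lam)"
    if ab: "a \<in> B" "b \<in> N" "b \<notin> B" "L a = L b" for a b
  proof -
    consider "a \<in> A" "b \<notin> A" | "a \<notin> A" "b \<in> A" | "a \<in> A \<longleftrightarrow> b \<in> A" by blast
    then show ?thesis
    proof cases
      case 1
      then have "(a, b) \<in> P" using ab BN by (auto simp: P_def)
      from lamP[OF this] 1 show ?thesis by simp
    next
      case 2
      show ?thesis
      proof (cases "lam = 0")
        case True
        then show ?thesis using single[OF ab] 2 hB by simp
      next
        case False
        \<comment> \<open>An outward exchange that gains exactly \<open>lam\<close> is paired with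
          the inward exchange of \<open>a\<close> for \<open>b\<close>.\<close>
        then obtain a1 b1 where 3: "(a1, b1) \<in> P" "lam = v a1 - v b1" using lam_in by auto
        then show ?thesis using double[OF 3(1), of a b] ab 2 by simp
      qed
    next
      case 3
      then show ?thesis using single[OF ab] hB by auto
    qed
  qed
  have "\<exists>s\<in>N. \<exists>t\<in>N. lam = max 0 (v s - v t)"
  proof (cases "lam = 0")
    case True
    moreover obtain i where "i \<in> N" using N(2) by blast
    ultimately show ?thesis by (intro bexI[of _ i]) auto
  next
    case False
    then obtain a b where "(a, b) \<in> P" "lam = v a - v b" using lam_in by auto
    then show ?thesis using lam0 by (intro bexI[of _ a] bexI[of _ b]) (auto simp: P_def)
  qed
  with slack order show ?thesis by blast
qed

text \<open>The threshold of a part is the largest cost chosen in it, or the smallest cost present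
  if nothing is chosen. Indices that label no item receive an arbitrary cost, so that every
  component of \<open>mu\<close> lies in the candidate list.\<close>

lemma separating_values:
  fixes ct :: "nat \<Rightarrow> real"
  assumes N: "finite N" "N \<noteq> {}" "B \<subseteq> N"
    and order: "\<And>a b. a \<in> B \<Longrightarrow> b \<in> N - B \<Longrightarrow> L a = L b \<Longrightarrow> ct a \<le> ct b"
  shows "\<exists>mu. (\<forall>r. mu r \<in> ct ` N) \<and> (\<forall>i\<in>B. ct i \<le> mu (L i)) \<and> (\<forall>i\<in>N - B. mu (L i) \<le> ct i)"
proof -
  have "\<exists>m\<in>ct ` N. (\<forall>i\<in>B. L i = r \<longrightarrow> ct i \<le> m) \<and> (\<forall>i\<in>N - B. L i = r \<longrightarrow> m \<le> ct i)" for r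
  proof (cases "{i\<in>B. L i = r} = {}")
    case False
    have f: "finite (ct ` {i\<in>B. L i = r})" using finite_subset[OF N(3,1)] by simp
    have "Max (ct ` {i\<in>B. L i = r}) \<in> ct ` {i\<in>B. L i = r}" using f False by (intro Max_in) auto
    then obtain a where a: "a \<in> B" "L a = r" "Max (ct ` {i\<in>B. L i = r}) = ct a" by auto
    have "ct i \<le> ct a" if "i \<in> B" "L i = r" for i
      unfolding a(3)[symmetric] using that f by (intro Max_ge) auto
    then show ?thesis using a order N(3) by (intro bexI[of _ "ct a"]) auto
  next
    case True
    show ?thesis
    proof (cases "{i\<in>N. L i = r} = {}")
      case True
      then show ?thesis using N(2,3) by blast
    next
      case False
      have f: "finite (ct ` {i\<in>N. L i = r})" using N by auto
      have "Min (ct ` {i\<in>N. L i = r}) \<in> ct ` {i\<in>N. L i = r}" using f False by (intro Min_in) auto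
      then obtain a where a: "a \<in> N" "L a = r" "Min (ct ` {i\<in>N. L i = r}) = ct a" by auto
      have "ct a \<le> ct i" if "i \<in> N" "L i = r" for i
        unfolding a(3)[symmetric] using that f by (intro Min_le) auto
      then show ?thesis using a True by (intro bexI[of _ "ct a"]) auto
    qed
  qed
  then obtain mu where "\<And>r. mu r \<in> ct ` N \<and> (\<forall>i\<in>B. L i = r \<longrightarrow> ct i \<le> mu r) \<and>
      (\<forall>i\<in>N - B. L i = r \<longrightarrow> mu r \<le> ct i)" by metis
  then show ?thesis by blast
qed

text \<open>Weak duality is tight for an optimal recovery: the thresholds confine the positive parts
  to \<open>B\<close>, and the distance bound is tight unless \<open>lam = 0\<close>.\<close>

lemma strong_duality:
  fixes v :: "nat \<Rightarrow> real"
  assumes N: "finite N" "N \<noteq> {}" and A: "A \<subseteq> N"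
  shows "\<exists>B\<in>recoveries N L A k. \<exists>s\<in>N. \<exists>t\<in>N. \<exists>lam mu. lam = max 0 (v s - v t) \<and>
    (\<forall>r. \<exists>i\<in>N. mu r = v i \<or> mu r = v i + lam) \<and>
    sum v B \<le> dual_sum N L A lam mu v - real (min k (card N)) * lam"
proof -
  let ?R = "recoveries N L A k"
  have "?R \<subseteq> Pow N" by (auto simp: recoveries_def)
  then have fR: "finite ?R" using N finite_subset by auto
  have "A \<in> ?R" using A by (auto simp: recoveries_def)
  then have "Min (sum v ` ?R) \<in> sum v ` ?R" using fR by (intro Min_in) auto
  then obtain B where B: "B \<in> ?R" "Min (sum v ` ?R) = sum v B" by auto
  have opt: "sum v B \<le> sum v B'" if "B' \<in> ?R" for B'
    unfolding B(2)[symmetric] using that fR by (intro Min_le) auto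
  have BN: "B \<subseteq> N" and fB: "finite B" and hB: "card (B - A) \<le> k"
    using B N by (auto simp: recoveries_def intro: finite_subset)
  obtain s t lam where st: "s \<in> N" "t \<in> N" "lam = max 0 (v s - v t)"
    and slack: "real (card (B - A)) * lam = real k * lam"
    and order: "\<forall>a\<in>B. \<forall>b\<in>N - B. L a = L b \<longrightarrow>
      v a + (if a \<in> A then 0 else lam) \<le> v b + (if b \<in> A then 0 else lam)"
    using optimal_penalty[OF N A B(1) opt] by blast
  let ?ct = "\<lambda>i. v i + (if i \<in> A then 0 else lam)"
  obtain mu where mu: "\<And>r. mu r \<in> ?ct ` N" "\<And>i. i \<in> B \<Longrightarrow> ?ct i \<le> mu (L i)"
    "\<And>i. i \<in> N - B \<Longrightarrow> mu (L i) \<le> ?ct i"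
    using separating_values[OF N BN, of L ?ct] order by blast
  \<comment> \<open>Outside \<open>B\<close> the threshold is at most the penalized cost, so the
    positive part vanishes; inside \<open>B\<close> it is the difference itself.\<close>
  have "(\<Sum>i\<in>N. max 0 (mu (L i) - ?ct i)) = (\<Sum>i\<in>B. mu (L i) - ?ct i)"
    using mu(2,3) BN N(1)
    by (intro sum.mono_neutral_cong_right) (auto simp del: add_0_right intro!: max_absorb1)
  then have "dual_sum N L A lam mu v = (\<Sum>i\<in>B. ?ct i)"
    by (simp add: dual_sum_eq[OF N(1) A B(1)] sum_subtractf)
  also have "\<dots> = sum v B + real (card (B - A)) * lam" by (rule sum_penalized[OF fB])
  finally have val: "dual_sum N L A lam mu v = sum v B + real (card (B - A)) * lam" .
  \<comment> \<open>Capping the distance bound only shrinks the subtracted term, as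
    \<open>lam\<close> is nonnegative.\<close>
  have "real (min k (card N)) * lam \<le> real k * lam"
    using st(3) by (intro mult_right_mono) auto
  then have "sum v B \<le> dual_sum N L A lam mu v - real (min k (card N)) * lam"
    using val slack by simp
  moreover have "\<exists>i\<in>N. mu r = v i \<or> mu r = v i + lam" for r
    using mu(1)[of r] by (auto split: if_splits)
  ultimately show ?thesis using B(1) st by blast
qed

section \<open>The dynamic program\<close>

definition dev_cost :: "(nat \<Rightarrow> real) \<Rightarrow> (nat \<Rightarrow> real) \<Rightarrow> nat set \<Rightarrow> nat \<Rightarrow> real" where
  "dev_cost c d Z i = c i + (if i \<in> Z then d i else 0)"

text \<open>
  Here \<open>S\<close> is the set of items processed so far and \<open>M\<close> the set of admissible multipliers;
  \<open>Z\<close> is the set of items whose costs deviate.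
\<close>

locale dual_dp =
  fixes n :: nat and L :: "nat \<Rightarrow> nat" and A :: "nat set" and c d :: "nat \<Rightarrow> real" and lam :: real
begin

abbreviation total :: "nat set \<Rightarrow> (nat \<Rightarrow> real) \<Rightarrow> nat set \<Rightarrow> real" where
  "total S mu Z \<equiv> dual_sum S L A lam mu (dev_cost c d Z)"

text \<open>Attainment together with an upper bound replaces \<open>Max\<close>, because
  \<open>mu\<close> and \<open>Z\<close> range over infinite families. Asking for at most
  \<open>b\<close> deviations keeps the entry meaningful when \<open>b\<close> exceeds the size of
  \<open>S\<close>.\<close>

definition table :: "nat set \<Rightarrow> (nat \<Rightarrow> real) set \<Rightarrow> (nat \<Rightarrow> real) \<Rightarrow> bool" where
  "table S M G \<longleftrightarrow> (\<forall>b\<le>n. (\<exists>Z. \<exists>mu\<in>M. card (S \<inter> Z) \<le> b \<and> G b = total S mu Z) \<and>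
     (\<forall>Z. \<forall>mu\<in>M. card (S \<inter> Z) \<le> b \<longrightarrow> total S mu Z \<le> G b))"

lemma table_cong: "table S M G \<Longrightarrow> (\<And>b. b \<le> n \<Longrightarrow> G' b = G b) \<Longrightarrow> table S M G'"
  by (auto simp: table_def)

lemma table_empty: "M \<noteq> {} \<Longrightarrow> table {} M (\<lambda>_. 0)"
  by (auto simp: table_def dual_sum_def)

text \<open>As long as no item labelled \<open>r\<close> has been processed, the value does not
  depend on \<open>mu r\<close>. The table for all multipliers is thus a valid start for each
  candidate value of the new part.\<close>

lemma table_restrict:
  assumes G: "table S M G" and S: "\<And>i. i \<in> S \<Longrightarrow> L i \<noteq> r"
    and M: "\<And>mu. mu \<in> M \<Longrightarrow> mu(r := u) \<in> M"
  shows "table S {mu\<in>M. mu r = u} G"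
proof -
  have "total S (mu(r := u)) Z = total S mu Z" for mu Z
    using S by (auto simp: dual_sum_def intro!: sum.cong)
  note tot = this
  show ?thesis unfolding table_def
  proof (intro allI impI conjI ballI)
    fix b assume "b \<le> n"
    then obtain Z mu where "mu \<in> M" "card (S \<inter> Z) \<le> b" "G b = total S mu Z"
      using G unfolding table_def by blast
    then show "\<exists>Z. \<exists>mu\<in>{mu \<in> M. mu r = u}. card (S \<inter> Z) \<le> b \<and> G b = total S mu Z"
      using M tot by (intro exI[of _ Z] bexI[of _ "mu(r := u)"]) auto
  next
    fix b Z mu assume "b \<le> n" "mu \<in> {mu \<in> M. mu r = u}" "card (S \<inter> Z) \<le> b"
    then show "total S mu Z \<le> G b" using G by (simp add: table_def)
  qed
qed

text \<open>A knapsack recurrence: the item keeps its cost, or deviates at the price of one unit of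
  budget. With the multiplier of its part fixed, an item contributes independently of the
  others.\<close>

lemma table_item:
  assumes G: "table S {mu\<in>M. mu r = u} G" and i: "finite S" "i \<notin> S" "L i = r"
    and G': "G' 0 = G 0 + contribution (i \<in> A) lam u (c i)"
      "\<And>b. b < n \<Longrightarrow> G' (Suc b) = max (G (Suc b) + contribution (i \<in> A) lam u (c i))
         (G b + contribution (i \<in> A) lam u (c i + d i))"
  shows "table (insert i S) {mu\<in>M. mu r = u} G'"
proof -
  let ?w0 = "contribution (i \<in> A) lam u (c i)"
  let ?w1 = "contribution (i \<in> A) lam u (c i + d i)"
  let ?M = "{mu\<in>M. mu r = u}"
  have tot: "total (insert i S) mu Z = total S mu Z + (if i \<in> Z then ?w1 else ?w0)"
    if "mu r = u" for mu Z
    using i that by (auto simp: dual_sum_def dev_cost_def)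
  have tot_cong: "total S mu Z = total S mu Z'" if "S \<inter> Z = S \<inter> Z'" for mu Z Z'
    unfolding dual_sum_def dev_cost_def using that
    by (intro sum.cong refl arg_cong[where f = "contribution _ _ _"]) auto
  have ach: "\<exists>Z. \<exists>mu\<in>?M. card (S \<inter> Z) \<le> b \<and> G b = total S mu Z"
    and dom: "\<And>Z mu. mu \<in> ?M \<Longrightarrow> card (S \<inter> Z) \<le> b \<Longrightarrow> total S mu Z \<le> G b" if "b \<le> n" for b
    using G that unfolding table_def by blast+
  have ach0: "\<exists>Z. \<exists>mu\<in>?M. card (insert i S \<inter> Z) \<le> b \<and> G b + ?w0 = total (insert i S) mu Z"
    if b: "b \<le> n" for b
  proof -
    obtain Z mu where Z: "mu \<in> ?M" "card (S \<inter> Z) \<le> b" "G b = total S mu Z"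
      using ach[OF b] by blast
    \<comment> \<open>Membership of \<open>i\<close> in \<open>Z\<close> may be changed freely,
      since the old table only sees \<open>S \<inter> Z\<close>.\<close>
    have "S \<inter> (Z - {i}) = S \<inter> Z" "insert i S \<inter> (Z - {i}) = S \<inter> Z" using i by auto
    then show ?thesis using Z tot[of mu "Z - {i}"] tot_cong[of "Z - {i}" Z]
      by (intro exI[of _ "Z - {i}"] bexI[of _ mu]) auto
  qed
  have ach1: "\<exists>Z. \<exists>mu\<in>?M. card (insert i S \<inter> Z) \<le> Suc b \<and> G b + ?w1 = total (insert i S) mu Z"
    if b: "b \<le> n" for b
  proof -
    obtain Z mu where Z: "mu \<in> ?M" "card (S \<inter> Z) \<le> b" "G b = total S mu Z"
      using ach[OF b] by blast
    have "S \<inter> insert i Z = S \<inter> Z" "insert i S \<inter> insert i Z = insert i (S \<inter> Z)" using i by auto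
    then show ?thesis using Z i tot[of mu "insert i Z"] tot_cong[of "insert i Z" Z]
      by (intro exI[of _ "insert i Z"] bexI[of _ mu]) auto
  qed
  have card: "card (insert i S \<inter> Z) = card (S \<inter> Z) + of_bool (i \<in> Z)" for Z
    using i by simp
  have main: "(\<exists>Z. \<exists>mu\<in>?M. card (insert i S \<inter> Z) \<le> b \<and> G' b = total (insert i S) mu Z) \<and>
    (\<forall>Z. \<forall>mu\<in>?M. card (insert i S \<inter> Z) \<le> b \<longrightarrow> total (insert i S) mu Z \<le> G' b)" if "b \<le> n" for b
  proof (cases b)
    case 0
    have "total (insert i S) mu Z \<le> G' 0" if "mu \<in> ?M" "card (insert i S \<inter> Z) \<le> 0" for mu Z
      using dom[of 0 mu Z] that tot[of mu Z] card[of Z] by (auto simp: G'(1) split: if_splits)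
    then show ?thesis using ach0[of 0] 0 by (simp add: G'(1))
  next
    case (Suc a)
    then have a: "a < n" "a \<le> n" "Suc a \<le> n" using that by auto
    have "total (insert i S) mu Z \<le> G' (Suc a)"
      if "mu \<in> ?M" "card (insert i S \<inter> Z) \<le> Suc a" for mu Z
      using dom[OF a(2), of mu Z] dom[OF a(3), of mu Z] that tot[of mu Z] card[of Z]
      by (cases "i \<in> Z") (auto simp: G'(2)[OF a(1)])
    moreover have "\<exists>Z. \<exists>mu\<in>?M. card (insert i S \<inter> Z) \<le> Suc a \<and> G' (Suc a) = total (insert i S) mu Z"
      using ach0[OF a(3)] ach1[OF a(2)] unfolding G'(2)[OF a(1)] max_def by presburger
    ultimately show ?thesis by (simp add: Suc)
  qed
  then show ?thesis unfolding table_def by blast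
qed

lemma table_max:
  assumes "table S {mu\<in>M. mu r \<in> U} H" "table S {mu\<in>M. mu r = u} G"
  shows "table S {mu\<in>M. mu r \<in> insert u U} (\<lambda>b. max (H b) (G b))"
  unfolding table_def
proof (intro allI impI)
  fix b assume b: "b \<le> n"
  have 1: "\<exists>Z. \<exists>mu\<in>M. mu r \<in> U \<and> card (S \<inter> Z) \<le> b \<and> H b = total S mu Z"
    and 2: "\<exists>Z. \<exists>mu\<in>M. mu r = u \<and> card (S \<inter> Z) \<le> b \<and> G b = total S mu Z"
    and 3: "\<And>Z mu. mu \<in> M \<Longrightarrow> mu r \<in> U \<Longrightarrow> card (S \<inter> Z) \<le> b \<Longrightarrow> total S mu Z \<le> H b"
    and 4: "\<And>Z mu. mu \<in> M \<Longrightarrow> mu r = u \<Longrightarrow> card (S \<inter> Z) \<le> b \<Longrightarrow> total S mu Z \<le> G b"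
    using assms b unfolding table_def by blast+
  have "\<exists>Z. \<exists>mu\<in>M. mu r \<in> insert u U \<and> card (S \<inter> Z) \<le> b \<and> max (H b) (G b) = total S mu Z"
  proof (cases "H b \<le> G b")
    case True
    with 2 show ?thesis by (metis insertI1 max_absorb2)
  next
    case False
    with 1 show ?thesis by (metis insertI2 linear max_absorb1)
  qed
  moreover have "total S mu Z \<le> max (H b) (G b)"
    if "mu \<in> M" "mu r \<in> insert u U" "card (S \<inter> Z) \<le> b" for mu Z
    using 3[of mu Z] 4[of mu Z] that by (cases "mu r = u") auto
  ultimately show "(\<exists>Z. \<exists>mu\<in>{mu\<in>M. mu r \<in> insert u U}. card (S \<inter> Z) \<le> b \<and>
        max (H b) (G b) = total S mu Z) \<and>
      (\<forall>Z. \<forall>mu\<in>{mu\<in>M. mu r \<in> insert u U}. card (S \<inter> Z) \<le> b \<longrightarrow>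
        total S mu Z \<le> max (H b) (G b))"
    by blast
qed

end

section \<open>The adversarial problem and its dual\<close>

text \<open>Vectors are indexed from 1, whereas sets contain array positions counted from 0; hence
  the shift.\<close>

definition indicator_vec :: "rms_instance \<Rightarrow> nat set \<Rightarrow> nat \<Rightarrow> real" where
  "indicator_vec I B = (\<lambda>i\<in>items I. if i - 1 \<in> B then 1 else 0)"

lemma sum_items: "(\<Sum>i\<in>items I. f i) = (\<Sum>i<num_items I. f (Suc i))"
  by (simp add: items_def sum.atLeast1_atMost_eq)

lemma indicator_vec_Suc: "i < num_items I \<Longrightarrow> indicator_vec I B (Suc i) = (if i \<in> B then 1 else 0)"
  by (simp add: indicator_vec_def items_def)

lemma indicator_vec_PiE: "indicator_vec I B \<in> items I \<rightarrow>\<^sub>E {0, 1}"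
  by (auto simp: indicator_vec_def)

lemma binary_vector:
  assumes "f \<in> items I \<rightarrow>\<^sub>E {0, 1 :: real}"
  shows "f = indicator_vec I {i. i < num_items I \<and> f (Suc i) = 1}"
proof
  fix i
  show "f i = indicator_vec I {i. i < num_items I \<and> f (Suc i) = 1} i"
  proof (cases "i \<in> items I")
    case True
    then have "f i \<in> {0, 1}" using assms by (auto simp: PiE_iff)
    then show ?thesis using True by (auto simp: indicator_vec_def items_def)
  next
    case False
    then show ?thesis using assms by (simp add: indicator_vec_def PiE_arb[of f])
  qed
qed

lemma sum_indicator_vec:
  assumes "B \<subseteq> {..<num_items I}" "P \<subseteq> items I"
  shows "(\<Sum>i\<in>P. g i * indicator_vec I B i) = (\<Sum>i\<in>{i\<in>B. Suc i \<in> P}. g (Suc i))"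
proof -
  have fin: "finite (items I)" by (simp add: items_def)
  have "(\<Sum>i\<in>P. g i * indicator_vec I B i) = (\<Sum>i\<in>items I. if i \<in> P then g i * indicator_vec I B i else 0)"
    using assms(2) fin by (simp add: sum.inter_restrict[symmetric] Int_absorb1)
  also have "\<dots> = (\<Sum>i<num_items I. if i \<in> {i\<in>B. Suc i \<in> P} then g (Suc i) else 0)"
    unfolding sum_items by (intro sum.cong) (auto simp: indicator_vec_Suc)
  also have "\<dots> = (\<Sum>i\<in>{i\<in>B. Suc i \<in> P}. g (Suc i))"
    using assms(1) by (intro sum.mono_neutral_cong_right) auto
  finally show ?thesis .
qed

lemma finite_recoveries: "finite N \<Longrightarrow> finite (recoveries N L A' k)"
  by (rule finite_subset[of _ "Pow N"]) (auto simp: recoveries_def)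

text \<open>Only the partition induced by \<open>L\<close> matters. This permits replacing part
  indices by the labels that the program computes.\<close>

lemma recoveries_cong:
  assumes "\<And>i j. i \<in> N \<Longrightarrow> j \<in> N \<Longrightarrow> L i = L j \<longleftrightarrow> L' i = L' j" "A' \<subseteq> N"
  shows "recoveries N L A' k = recoveries N L' A' k"
proof -
  have "{i\<in>B. L i = L r} = {i\<in>B. L' i = L' r}" if "B \<subseteq> N" "r \<in> N" for B r
    using that assms(1) by blast
  then show ?thesis unfolding recoveries_def using assms(2) by auto
qed

locale adversary =
  fixes I :: rms_instance and x :: "nat \<Rightarrow> real"
  assumes valid: "valid_instance I" and x_feasible: "x \<in> feasible I"
begin

definition "n = num_items I"
definition "q i = part_index I (Suc i)"
definition "A = {i. i < n \<and> x (Suc i) = 1}"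
definition "c i = base_cost I (Suc i)"
definition "d i = deviation I (Suc i)"

lemma A_subset: "A \<subseteq> {..<n}" by (auto simp: A_def)

lemma x_eq: "x = indicator_vec I A"
proof -
  have "x \<in> items I \<rightarrow>\<^sub>E {0, 1}" using x_feasible by (simp add: feasible_def)
  from binary_vector[OF this] show ?thesis unfolding A_def n_def .
qed

lemma part_index:
  assumes "i \<in> items I"
  shows "part_index I i \<in> {1..num_parts I}" "i \<in> part I (part_index I i)"
    and "j \<in> {1..num_parts I} \<Longrightarrow> i \<in> part I j \<Longrightarrow> part_index I i = j"
proof -
  obtain j0 where j0: "j0 \<in> {1..num_parts I}" "i \<in> part I j0"
    using valid assms unfolding valid_instance_def by blast
  have u: "j = j0" if "j \<in> {1..num_parts I}" "i \<in> part I j" for j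
    using valid that j0 unfolding valid_instance_def disjoint_family_on_def by blast
  have eq: "part_index I i = j0"
    unfolding part_index_def by (rule the_equality) (use j0 u in blast)+
  show "part_index I i \<in> {1..num_parts I}" "i \<in> part I (part_index I i)"
    and "j \<in> {1..num_parts I} \<Longrightarrow> i \<in> part I j \<Longrightarrow> part_index I i = j"
    unfolding eq using j0 u by blast+
qed

lemma part_subset: "j \<in> {1..num_parts I} \<Longrightarrow> part I j \<subseteq> items I"
  using valid by (auto simp: valid_instance_def)

lemma card_part:
  assumes "B \<subseteq> {..<n}" "j \<in> {1..num_parts I}"
  shows "(\<Sum>i\<in>part I j. indicator_vec I B i) = real (card {i\<in>B. q i = j})"
proof -
  have "Suc i \<in> part I j \<longleftrightarrow> q i = j" if "i \<in> B" for i
  proof -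
    have "Suc i \<in> items I" using assms(1) that by (auto simp: items_def n_def)
    then show ?thesis using part_index[of "Suc i"] assms(2) unfolding q_def by blast
  qed
  then have eq: "{i\<in>B. Suc i \<in> part I j} = {i\<in>B. q i = j}" by auto
  have "(\<Sum>i\<in>part I j. 1 * indicator_vec I B i) = (\<Sum>i\<in>{i\<in>B. Suc i \<in> part I j}. 1)"
    using assms part_subset by (intro sum_indicator_vec) (auto simp: n_def)
  then show ?thesis unfolding eq by simp
qed

text \<open>Since \<open>x\<close> is feasible, the demands are the part sizes of \<open>A\<close>.
  A part index that no item has gives the empty set on both sides.\<close>

lemma indicator_feasible_iff:
  assumes B: "B \<subseteq> {..<n}"
  shows "indicator_vec I B \<in> feasible I \<longleftrightarrow>
    (\<forall>r\<in>{..<n}. card {i\<in>B. q i = q r} = card {i\<in>A. q i = q r})"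
proof -
  have demand: "card {i\<in>A. q i = j} = demand I j" if "j \<in> {1..num_parts I}" for j
    using x_feasible card_part[OF A_subset that] that by (simp add: feasible_def x_eq[symmetric])
  have "indicator_vec I B \<in> feasible I \<longleftrightarrow>
      (\<forall>j\<in>{1..num_parts I}. card {i\<in>B. q i = j} = card {i\<in>A. q i = j})"
    using demand card_part[OF B] indicator_vec_PiE by (simp add: feasible_def)
  also have "\<dots> \<longleftrightarrow> (\<forall>r\<in>{..<n}. card {i\<in>B. q i = q r} = card {i\<in>A. q i = q r})"
  proof (intro iffI ballI)
    fix r assume "r \<in> {..<n}"
    then have "q r \<in> {1..num_parts I}" using part_index(1)[of "Suc r"] by (auto simp: q_def items_def n_def)
    moreover assume "\<forall>j\<in>{1..num_parts I}. card {i\<in>B. q i = j} = card {i\<in>A. q i = j}"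
    ultimately show "card {i\<in>B. q i = q r} = card {i\<in>A. q i = q r}" by blast
  next
    fix j
    assume *: "\<forall>r\<in>{..<n}. card {i\<in>B. q i = q r} = card {i\<in>A. q i = q r}"
    show "card {i\<in>B. q i = j} = card {i\<in>A. q i = j}"
    proof (cases "\<exists>r<n. q r = j")
      case False
      then have "{i\<in>B. q i = j} = {}" "{i\<in>A. q i = j} = {}" using B A_subset by auto
      then show ?thesis by (simp only:)
    qed (use * in auto)
  qed
  finally show ?thesis .
qed

text \<open>Equal part sizes give \<open>A\<close> and \<open>B\<close> equal cardinality, so
  \<open>A - B\<close> and \<open>B - A\<close> are equally large. Distance at most
  \<open>2 k\<close> therefore becomes \<open>card (B - A) \<le> k\<close>.\<close>

lemma distance:
  assumes B: "B \<subseteq> {..<n}" and parts: "\<forall>r\<in>{..<n}. card {i\<in>B. q i = q r} = card {i\<in>A. q i = q r}"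
  shows "(\<Sum>i\<in>items I. \<bar>x i - indicator_vec I B i\<bar>) = 2 * real (card (B - A))"
proof -
  have f: "finite A" "finite B" using A_subset B finite_subset by auto
  have "B \<in> recoveries {..<n} q A (card (B - A))" using B parts by (simp add: recoveries_def)
  from sum_parts_recovery[OF _ A_subset this, of "\<lambda>_. 1"] have "card B = card A" by simp
  then have eq: "card (A - B) = card (B - A)"
    using f by (simp add: card_Diff_subset_Int Int_commute)
  have "(\<Sum>i\<in>items I. \<bar>x i - indicator_vec I B i\<bar>) = (\<Sum>i<n. of_bool (i \<in> A - B) + of_bool (i \<in> B - A))"
    unfolding sum_items x_eq[symmetric] n_def
    by (subst x_eq, intro sum.cong) (auto simp: indicator_vec_Suc)
  also have "\<dots> = real (card ({..<n} \<inter> (A - B))) + real (card ({..<n} \<inter> (B - A)))"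
    by (simp add: sum.distrib set_diff_eq)
  also have "\<dots> = real (card (A - B)) + real (card (B - A))"
    using A_subset B by (simp add: Int_absorb1 subset_eq)
  finally show ?thesis using eq by simp
qed

lemma recovery_set_eq:
  "recovery_set I x = indicator_vec I ` recoveries {..<n} q A (recovery I)"
proof (intro subset_antisym subsetI)
  fix y assume y: "y \<in> recovery_set I x"
  define B where "B = {i. i < n \<and> y (Suc i) = 1}"
  have B: "B \<subseteq> {..<n}" by (auto simp: B_def)
  have "y \<in> items I \<rightarrow>\<^sub>E {0, 1}" using y by (simp add: recovery_set_def feasible_def)
  from binary_vector[OF this] have eq: "y = indicator_vec I B" unfolding B_def n_def .
  have parts: "\<forall>r\<in>{..<n}. card {i\<in>B. q i = q r} = card {i\<in>A. q i = q r}"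
    using indicator_feasible_iff[OF B] y eq by (simp add: recovery_set_def)
  have "2 * real (card (B - A)) \<le> 2 * real (recovery I)"
    using y distance[OF B parts] eq by (simp add: recovery_set_def)
  then show "y \<in> indicator_vec I ` recoveries {..<n} q A (recovery I)"
    using B parts eq by (auto simp: recoveries_def)
next
  fix y assume "y \<in> indicator_vec I ` recoveries {..<n} q A (recovery I)"
  then obtain B where "y = indicator_vec I B" "B \<in> recoveries {..<n} q A (recovery I)" by blast
  then show "y \<in> recovery_set I x"
    using indicator_feasible_iff[of B] distance[of B] by (simp add: recoveries_def recovery_set_def)
qed

lemma uncertainty_set_eq:
  "uncertainty_set I = (\<lambda>Z. \<lambda>i\<in>items I. base_cost I i + deviation I i * indicator_vec I Z i) `
     {Z. Z \<subseteq> {..<n} \<and> card Z \<le> budget I}"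
proof -
  have card: "(\<Sum>i\<in>items I. indicator_vec I Z i) = real (card Z)" if "Z \<subseteq> {..<n}" for Z
  proof -
    have "{i\<in>Z. Suc i \<in> items I} = Z" using that by (auto simp: items_def n_def)
    then show ?thesis using sum_indicator_vec[of Z I "items I" "\<lambda>_. 1"] that by (simp add: n_def)
  qed
  show ?thesis
  proof (intro subset_antisym subsetI)
    fix f assume "f \<in> uncertainty_set I"
    then obtain \<delta> where f: "f = (\<lambda>i\<in>items I. base_cost I i + deviation I i * \<delta> i)"
      and \<delta>: "\<delta> \<in> items I \<rightarrow>\<^sub>E {0, 1}" "(\<Sum>i\<in>items I. \<delta> i) \<le> real (budget I)"
      unfolding uncertainty_set_def by blast
    define Z where "Z = {i. i < n \<and> \<delta> (Suc i) = 1}"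
    have Z: "Z \<subseteq> {..<n}" "\<delta> = indicator_vec I Z"
      using binary_vector[OF \<delta>(1)] unfolding Z_def n_def by auto
    show "f \<in> (\<lambda>Z. \<lambda>i\<in>items I. base_cost I i + deviation I i * indicator_vec I Z i) `
        {Z. Z \<subseteq> {..<n} \<and> card Z \<le> budget I}"
      using f \<delta>(2) card[OF Z(1)] Z by auto
  next
    fix f assume "f \<in> (\<lambda>Z. \<lambda>i\<in>items I. base_cost I i + deviation I i * indicator_vec I Z i) `
        {Z. Z \<subseteq> {..<n} \<and> card Z \<le> budget I}"
    then obtain Z where "Z \<subseteq> {..<n}" "card Z \<le> budget I"
      "f = (\<lambda>i\<in>items I. base_cost I i + deviation I i * indicator_vec I Z i)" by blast
    then show "f \<in> uncertainty_set I"
      unfolding uncertainty_set_def using card[of Z] indicator_vec_PiE[of I Z] by auto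
  qed
qed

lemma Adv_eq: "Adv I x = (MAX Z\<in>{Z. Z \<subseteq> {..<n} \<and> card Z \<le> budget I}.
    MIN B\<in>recoveries {..<n} q A (recovery I). sum (dev_cost c d Z) B)"
proof -
  have inner: "(\<Sum>i\<in>items I. (\<lambda>i\<in>items I. base_cost I i + deviation I i * indicator_vec I Z i) i *
      indicator_vec I B i) = sum (dev_cost c d Z) B"
    if "Z \<subseteq> {..<n}" "B \<subseteq> {..<n}" for Z B
  proof -
    have "(\<Sum>i\<in>items I. (\<lambda>i\<in>items I. base_cost I i + deviation I i * indicator_vec I Z i) i *
      indicator_vec I B i) = (\<Sum>i\<in>items I. (base_cost I i + deviation I i * indicator_vec I Z i) *
      indicator_vec I B i)" by (intro sum.cong) auto
    also have "\<dots> = (\<Sum>i\<in>{i\<in>B. Suc i \<in> items I}. base_cost I (Suc i) + deviation I (Suc i) * indicator_vec I Z (Suc i))"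
      using that by (intro sum_indicator_vec) (auto simp: n_def)
    also have "{i\<in>B. Suc i \<in> items I} = B" using that by (auto simp: items_def n_def)
    also have "(\<Sum>i\<in>B. base_cost I (Suc i) + deviation I (Suc i) * indicator_vec I Z (Suc i)) =
        sum (dev_cost c d Z) B"
      using that by (intro sum.cong) (auto simp: dev_cost_def c_def d_def indicator_vec_Suc n_def)
    finally show ?thesis .
  qed
  have "(MIN y\<in>recovery_set I x. \<Sum>i\<in>items I. (\<lambda>i\<in>items I. base_cost I i + deviation I i * indicator_vec I Z i) i * y i) =
      (MIN B\<in>recoveries {..<n} q A (recovery I). sum (dev_cost c d Z) B)" if "Z \<subseteq> {..<n}" for Z
    unfolding recovery_set_eq image_image
    by (intro arg_cong[where f = Min] image_cong refl inner that) (auto simp: recoveries_def)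
  then show ?thesis unfolding Adv_def uncertainty_set_eq image_image
    by (intro arg_cong[where f = Max] image_cong refl) auto
qed

lemma dual_le_Adv:
  assumes L: "\<And>i j. i < n \<Longrightarrow> j < n \<Longrightarrow> L i = L j \<longleftrightarrow> q i = q j"
    and "0 \<le> lam" "card ({..<n} \<inter> Z) \<le> budget I"
  shows "dual_sum {..<n} L A lam mu (dev_cost c d Z) - real (min (recovery I) n) * lam \<le> Adv I x"
proof -
  let ?R = "recoveries {..<n} q A (recovery I)" and ?Z = "{..<n} \<inter> Z"
  have R: "?R = recoveries {..<n} L A (recovery I)"
    using L A_subset by (intro recoveries_cong) auto
  have "dual_sum {..<n} L A lam mu (dev_cost c d Z) = dual_sum {..<n} L A lam mu (dev_cost c d ?Z)"
    unfolding dual_sum_def dev_cost_def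
    by (intro sum.cong refl arg_cong[where f = "contribution _ _ _"]) auto
  moreover have "dual_sum {..<n} L A lam mu (dev_cost c d ?Z) - real (min (recovery I) n) * lam \<le>
      sum (dev_cost c d ?Z) B" if "B \<in> ?R" for B
    using weak_duality[OF _ A_subset that[unfolded R] assms(2)] by simp
  moreover have "A \<in> ?R" using A_subset by (simp add: recoveries_def)
  ultimately have "dual_sum {..<n} L A lam mu (dev_cost c d Z) - real (min (recovery I) n) * lam \<le>
      (MIN B\<in>?R. sum (dev_cost c d ?Z) B)"
    by (subst Min_ge_iff) (auto simp: finite_recoveries)
  also have "\<dots> \<le> Adv I x" unfolding Adv_eq using assms(3) by (intro Max_ge) auto
  finally show ?thesis .
qed

text \<open>Strong duality is applied to the costs of a worst deviating set. Such a set has at most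
  \<open>n\<close> elements, which justifies capping the budget.\<close>

lemma Adv_le_dual:
  assumes L: "\<And>i j. i < n \<Longrightarrow> j < n \<Longrightarrow> L i = L j \<longleftrightarrow> q i = q j" and "0 < n"
  shows "\<exists>Z s t lam mu. card ({..<n} \<inter> Z) \<le> min (budget I) n \<and> s < n \<and> t < n \<and>
    lam = max 0 (dev_cost c d Z s - dev_cost c d Z t) \<and>
    (\<forall>r. \<exists>i<n. mu r = dev_cost c d Z i \<or> mu r = dev_cost c d Z i + lam) \<and>
    Adv I x \<le> dual_sum {..<n} L A lam mu (dev_cost c d Z) - real (min (recovery I) n) * lam"
proof -
  let ?R = "recoveries {..<n} q A (recovery I)" and ?U = "{Z. Z \<subseteq> {..<n} \<and> card Z \<le> budget I}"
  have R: "?R = recoveries {..<n} L A (recovery I)"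
    using L A_subset by (intro recoveries_cong) auto
  have "{} \<in> ?U" by simp
  then have "Adv I x \<in> (\<lambda>Z. MIN B\<in>?R. sum (dev_cost c d Z) B) ` ?U"
    unfolding Adv_eq by (intro Max_in) auto
  then obtain Z where Z: "Z \<subseteq> {..<n}" "card Z \<le> budget I"
    "Adv I x = (MIN B\<in>?R. sum (dev_cost c d Z) B)" by blast
  have "{..<n} \<noteq> {}" using \<open>0 < n\<close> by auto
  from strong_duality[OF finite_lessThan this A_subset, of L "recovery I" "dev_cost c d Z"]
  obtain B s t lam mu where B: "B \<in> ?R" "s < n" "t < n"
    "lam = max 0 (dev_cost c d Z s - dev_cost c d Z t)"
    "\<forall>r. \<exists>i\<in>{..<n}. mu r = dev_cost c d Z i \<or> mu r = dev_cost c d Z i + lam"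
    "sum (dev_cost c d Z) B \<le> dual_sum {..<n} L A lam mu (dev_cost c d Z) -
      real (min (recovery I) (card {..<n})) * lam"
    unfolding R by auto
  have "Adv I x \<le> sum (dev_cost c d Z) B"
    unfolding Z(3) using B(1) by (intro Min_le) (auto simp: finite_recoveries)
  moreover have "card ({..<n} \<inter> Z) \<le> min (budget I) n"
    using Z card_mono[of "{..<n}" Z] by (simp add: Int_absorb1)
  ultimately show ?thesis using B
    by (intro exI[of _ Z] exI[of _ s] exI[of _ t] exI[of _ lam] exI[of _ mu]) auto
qed

text \<open>In this case no loop of the search runs and the result register keeps its initial
  0.\<close>

lemma Adv_no_items: "n = 0 \<Longrightarrow> Adv I x = 0"
proof -
  assume n: "n = 0"
  have "{Z. Z \<subseteq> {..<n} \<and> card Z \<le> budget I} = {{}}" "recoveries {..<n} q A (recovery I) = {{}}"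
    using n A_subset by (auto simp: recoveries_def)
  then show ?thesis unfolding Adv_eq by simp
qed

end

section \<open>The program\<close>

abbreviation (input) "rBest \<equiv> 0 :: nat"
abbreviation (input) "rZero \<equiv> 2 :: nat"
abbreviation (input) "rN \<equiv> 3 :: nat"
abbreviation (input) "rN1 \<equiv> 4 :: nat"
abbreviation (input) "rN2 \<equiv> 5 :: nat"
abbreviation (input) "rN4 \<equiv> 6 :: nat"
abbreviation (input) "rGamma \<equiv> 7 :: nat"
abbreviation (input) "rK \<equiv> 8 :: nat"
abbreviation (input) "rI \<equiv> 9 :: nat"
abbreviation (input) "rJ \<equiv> 10 :: nat"
abbreviation (input) "rS \<equiv> 11 :: nat"
abbreviation (input) "rT \<equiv> 12 :: nat"
abbreviation (input) "rR \<equiv> 13 :: nat"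
abbreviation (input) "rM \<equiv> 14 :: nat"
abbreviation (input) "rB \<equiv> 15 :: nat"
abbreviation (input) "rLam \<equiv> 16 :: nat"
abbreviation (input) "rMu \<equiv> 17 :: nat"
abbreviation (input) "rW0 \<equiv> 18 :: nat"
abbreviation (input) "rW1 \<equiv> 19 :: nat"
abbreviation (input) "rPrev \<equiv> 20 :: nat"
abbreviation (input) "rCur \<equiv> 21 :: nat"
abbreviation (input) "rX \<equiv> 22 :: nat"
abbreviation (input) "rY \<equiv> 23 :: nat"
abbreviation (input) "rPen \<equiv> 24 :: nat"

text \<open>
  Arrays 0 to 5 are the input. Array \<open>aL\<close> labels the parts by their last items, \<open>aV\<close> holds the
  possible item costs, \<open>aU\<close> the candidate multipliers of a part, \<open>aF\<close> the table after
  the parts processed so far, \<open>aG\<close> its extension for one candidate, \<open>aH\<close> the maximum over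
  the candidates.
\<close>

abbreviation (input) "aPart \<equiv> 1 :: nat"
abbreviation (input) "aC \<equiv> 3 :: nat"
abbreviation (input) "aD \<equiv> 4 :: nat"
abbreviation (input) "aX \<equiv> 5 :: nat"
abbreviation (input) "aL \<equiv> 6 :: nat"
abbreviation (input) "aV \<equiv> 7 :: nat"
abbreviation (input) "aU \<equiv> 8 :: nat"
abbreviation (input) "aF \<equiv> 9 :: nat"
abbreviation (input) "aG \<equiv> 10 :: nat"
abbreviation (input) "aH \<equiv> 11 :: nat"

text \<open>\<open>rCur\<close> holds the multiplier minus the penalized cost, first without and
  then with deviation; comparing it with zero computes the positive part in
  \<open>contribution\<close>.\<close>

definition weights :: code where
  "weights =
    Block [Load rX aX rI, Load rCur aC rI, Arith Minus rCur rMu rCur] ;;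
    If rX rZero
      (Block [Arith Minus rCur rCur rLam, Const rW0 0, Const rW1 0])
      (Block [Move rW0 rMu, Move rW1 rMu]) ;;
    If rCur rZero Nop (Block [Arith Minus rW0 rW0 rCur]) ;;
    Block [Load rX aD rI, Arith Minus rCur rCur rX] ;;
    If rCur rZero Nop (Block [Arith Minus rW1 rW1 rCur])"

text \<open>The table is updated in place with increasing budget, so the old value of the previous
  entry has to be saved in \<open>rPrev\<close>.\<close>

definition row :: code where
  "row =
    Block [Load rPrev aG rZero, Arith Plus rX rPrev rW0, Store aG rZero rX] ;;
    For rB rN
      (Block [Const rY 1, Arith Plus rY rB rY, Load rCur aG rY, Arith Plus rX rCur rW0,
         Arith Plus rPrev rPrev rW1] ;;
       If rX rPrev (Block [Move rX rPrev]) Nop ;;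
       Block [Store aG rY rX, Move rPrev rCur])"

definition process_items :: code where
  "process_items = For rI rN
    (Block [Load rX aL rI] ;; If rX rR (If rR rX (weights ;; row) Nop) Nop)"

definition copy :: "nat \<Rightarrow> nat \<Rightarrow> code" where
  "copy a b = For rB rN1 (Block [Load rX a rB, Store b rB rX])"

text \<open>The first candidate overwrites \<open>aH\<close>, whose old contents belong to an
  earlier stage and could wrongly win the maximum.\<close>

definition merge :: code where
  "merge = For rB rN1
    (Block [Load rX aG rB] ;;
     If rM rZero Nop (Block [Load rY aH rB] ;; If rX rY (Block [Move rX rY]) Nop) ;;
     Block [Store aH rB rX])"

definition process_part :: code where
  "process_part = For rM rN4
    (Block [Load rMu aU rM] ;; copy aF aG ;; process_items ;; merge)"

text \<open>Every position \<open>rR\<close> is tried as a label. If it labels no part, no item is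
  processed, each candidate reproduces \<open>aF\<close>, and so does their maximum.\<close>

definition process_parts :: code where
  "process_parts = For rB rN1 (Block [Store aF rB rZero]) ;; For rR rN (process_part ;; copy aH aF)"

definition multipliers :: code where
  "multipliers = For rM rN2
    (Block [Load rX aV rM, Store aU rM rX, Arith Plus rX rX rLam, Arith Plus rY rN2 rM, Store aU rY rX])"

text \<open>\<open>rLam\<close> is added once for each counter value below \<open>k\<close>, that is
  \<open>min k n\<close> times: a product without multiplication, in a loop of length
  \<open>n\<close>.\<close>

definition penalty :: code where
  "penalty = Block [Const rPen 0] ;;
    For rI rN (If rK rI Nop (Block [Arith Plus rPen rPen rLam]))"

definition evaluate :: code where
  "evaluate =
    Block [Load rLam aV rS, Load rX aV rT, Arith Minus rLam rLam rX] ;;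
    If rLam rZero (Block [Const rLam 0]) Nop ;;
    penalty ;; multipliers ;; process_parts ;;
    Block [Load rX aF rGamma, Arith Minus rX rX rPen]"

text \<open>The optimum may be negative, so the first pair, recognized by
  \<open>rS + rT = 0\<close>, initializes \<open>rBest\<close>.\<close>

definition search :: code where
  "search = For rS rN2 (For rT rN2
    (evaluate ;; Block [Arith Plus rY rS rT] ;;
     If rY rZero (Block [Move rBest rX]) (If rX rBest Nop (Block [Move rBest rX]))))"

text \<open>Later items overwrite earlier ones, so the last item of the part remains. Equality is
  tested by two comparisons.\<close>

definition leaders :: code where
  "leaders = For rI rN (For rJ rN
    (Block [Load rX aPart rI, Load rY aPart rJ] ;;
     If rX rY (If rY rX (Block [Store aL rI rJ]) Nop) Nop))"

definition candidate_costs :: code where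
  "candidate_costs = For rI rN
    (Block [Load rX aC rI, Store aV rI rX, Load rY aD rI, Arith Plus rX rX rY, Arith Plus rJ rN rI,
       Store aV rJ rX])"

text \<open>The budget is capped because it serves as a table position; \<open>k\<close> is only
  compared with a counter in \<open>penalty\<close>, which caps it implicitly.\<close>

definition setup_regs :: code where
  "setup_regs =
    Block [Load rN 0 rZero, Const rX 1, Arith Plus rN1 rN rX, Arith Plus rN2 rN rN,
      Arith Plus rN4 rN2 rN2, Const rX 2, Load rGamma 0 rX, Const rX 3, Load rK 0 rX] ;;
    If rN rGamma (Block [Move rGamma rN]) Nop"

definition adv_code :: code where
  "adv_code = setup_regs ;; leaders ;; candidate_costs ;; search"

section \<open>Correctness of the program\<close>

lemma written_weights:
  "written_regs weights = {rX, rCur, rW0, rW1}" "written_arrs weights = {}"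
  by (auto simp: weights_def)

lemma written_row:
  "written_regs row = {1, rB, rY, rCur, rX, rPrev}" "written_arrs row = {aG}"
  by (auto simp: row_def)

lemma written_process_items:
  "written_regs process_items = {1, rI, rB, rY, rCur, rX, rPrev, rW0, rW1}"
  "written_arrs process_items = {aG}"
  by (auto simp: process_items_def written_weights written_row)

lemma written_copy: "written_regs (copy a b) = {1, rB, rX}" "written_arrs (copy a b) = {b}"
  by (auto simp: copy_def)

lemma written_merge: "written_regs merge = {1, rB, rX, rY}" "written_arrs merge = {aH}"
  by (auto simp: merge_def)

lemma written_process_part:
  "written_regs process_part = {1, rI, rB, rY, rCur, rX, rPrev, rW0, rW1, rM, rMu}"
  "written_arrs process_part = {aG, aH}"
  by (auto simp: process_part_def written_process_items written_copy written_merge)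

lemma written_process_parts:
  "written_regs process_parts = {1, rI, rB, rY, rCur, rX, rPrev, rW0, rW1, rM, rMu, rR}"
  "written_arrs process_parts = {aF, aG, aH}"
  by (auto simp: process_parts_def written_process_part written_copy)

lemma written_multipliers:
  "written_regs multipliers = {1, rM, rX, rY}" "written_arrs multipliers = {aU}"
  by (auto simp: multipliers_def)

lemma written_penalty: "written_regs penalty = {1, rI, rPen}" "written_arrs penalty = {}"
  by (auto simp: penalty_def)

lemma written_evaluate:
  "written_regs evaluate =
    {1, rI, rB, rY, rCur, rX, rPrev, rW0, rW1, rM, rMu, rR, rPen, rLam}"
  "written_arrs evaluate = {aF, aG, aH, aU}"
  by (auto simp: evaluate_def written_process_parts written_multipliers written_penalty)

lemmas written = written_weights written_row written_process_items written_copy written_merge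
  written_process_part written_process_parts written_multipliers written_penalty written_evaluate

text \<open>These rules simplify computed array positions such as \<open>n + i\<close>.\<close>

lemma nat_int_add [simp]:
  "nat (int a + int b) = a + b" "nat (int a + 1) = Suc a" "nat (1 + int a) = Suc a"
  by auto

lemma achieves_Then':
  assumes "achieves n c s P"
    and "\<And>s'. P s' \<Longrightarrow> frame (written_regs c) (written_arrs c) s s' \<Longrightarrow> achieves n d s' Q"
  shows "achieves n (c ;; d) s Q"
  by (rule achieves_Then, rule achieves_conseq[OF assms(1)]) (rule assms(2))

lemma copy_correct:
  assumes "regs s rN1 = real (n + 1)" "a \<noteq> b"
  shows "achieves n (copy a b) s (\<lambda>s'. \<forall>i\<le>n. arrs s' b i = arrs s a i)"
  unfolding copy_def
  apply (insert assms)
  apply (rule achieves_For[where K = "n + 1" and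
        Inv = "\<lambda>m s'. arrs s' a = arrs s a \<and> (\<forall>i<m. arrs s' b i = arrs s a i)"])
  apply (simp_all add: less_Suc_eq_le del: of_nat_Suc of_nat_add)
  apply (rule achieves_Block, auto simp: le_less)
  done

lemma row_correct:
  assumes "regs s rZero = 0" "regs s rN = real n" "regs s rW0 = w0" "regs s rW1 = w1"
  shows "achieves n row s (\<lambda>s'. arrs s' aG 0 = arrs s aG 0 + w0 \<and>
    (\<forall>b<n. arrs s' aG (Suc b) = max (arrs s aG (Suc b) + w0) (arrs s aG b + w1)))"
  unfolding row_def
  apply (insert assms)
  apply (rule achieves_Then, rule achieves_Block, simp)
  \<comment> \<open>\<open>rPrev\<close> holds the old entry at \<open>m\<close>, which the update
    of entry \<open>Suc m\<close> needs; all entries beyond \<open>m\<close> are still old.\<close>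
  apply (rule achieves_For[where K = n and Inv = "\<lambda>m s'. regs s' rPrev = arrs s aG m \<and>
      regs s' rW0 = w0 \<and> regs s' rW1 = w1 \<and> arrs s' aG 0 = arrs s aG 0 + w0 \<and>
      (\<forall>b<m. arrs s' aG (Suc b) = max (arrs s aG (Suc b) + w0) (arrs s aG b + w1)) \<and>
      (\<forall>b>m. arrs s' aG b = arrs s aG b)"])
            apply simp_all
  apply (rule achieves_Then | (rule achieves_Block, simp) | rule achieves_If | rule achieves_Nop
      | (auto simp: less_Suc_eq; fail))+
  done

lemma regs_update_same [simp]: "s\<lparr>regs := regs s\<rparr> = s"
  by simp

text \<open>The default 0 agrees with the initial content of the label array; it is not reached when
  \<open>i < m\<close>.\<close>

fun last_same :: "(nat \<Rightarrow> nat) \<Rightarrow> nat \<Rightarrow> nat \<Rightarrow> nat" where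
  "last_same q i 0 = 0"
| "last_same q i (Suc m) = (if q i = q m then m else last_same q i m)"

lemma last_same: "i < m \<Longrightarrow> last_same q i m < m \<and> q (last_same q i m) = q i"
  by (induction m) (auto simp: less_Suc_eq)

lemma last_same_cong: "q i = q j \<Longrightarrow> last_same q i m = last_same q j m"
  by (induction m) auto

context adversary
begin

definition static :: "machine_state \<Rightarrow> bool" where
  "static s \<longleftrightarrow> regs s rZero = 0 \<and> regs s rN = real n \<and> regs s rN1 = real (n + 1) \<and>
     regs s rN2 = real (2 * n) \<and> regs s rN4 = real (4 * n) \<and>
     regs s rGamma = real (min (budget I) n) \<and> regs s rK = real (recovery I) \<and>
     (\<forall>i<n. arrs s aPart i = real (q i)) \<and> (\<forall>i<n. arrs s aC i = c i) \<and> (\<forall>i<n. arrs s aD i = d i) \<and>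
     (\<forall>i<n. arrs s aX i = (if i \<in> A then 1 else 0))"

lemma static_regs:
  assumes "static s"
  shows "regs s rZero = 0" "regs s rN = real n" "regs s rN1 = real (n + 1)"
    "regs s rN2 = real (2 * n)" "regs s rN4 = real (4 * n)"
    "regs s rGamma = real (min (budget I) n)" "regs s rK = real (recovery I)"
  using assms by (auto simp: static_def)

lemma static_arrs:
  assumes "static s" "i < n"
  shows "arrs s aPart i = real (q i)" "arrs s aC i = c i" "arrs s aD i = d i"
    "arrs s aX i = (if i \<in> A then 1 else 0)"
  using assms by (auto simp: static_def)

lemma static_frame:
  assumes "static s" "frame R Q s s'"
    and "R \<inter> {rZero, rN, rN1, rN2, rN4, rGamma, rK} = {}" "Q \<inter> {aPart, aC, aD, aX} = {}"
  shows "static s'"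
  using assms unfolding static_def frame_def by auto

text \<open>\<open>f\<close> is arbitrary, so that simplification can peel off a chain of register
  updates one by one.\<close>

lemma static_upd [simp]:
  "r \<notin> {rZero, rN, rN1, rN2, rN4, rGamma, rK} \<Longrightarrow>
    static (s\<lparr>regs := f(r := v)\<rparr>) = static (s\<lparr>regs := f\<rparr>)"
  by (auto simp: static_def)

lemma weights_correct:
  assumes "static s" "regs s rI = real i" "i < n" "regs s rLam = lam" "regs s rMu = mu"
  shows "achieves n weights s (\<lambda>s'. regs s' rW0 = contribution (i \<in> A) lam mu (c i) \<and>
    regs s' rW1 = contribution (i \<in> A) lam mu (c i + d i))"
  unfolding weights_def
  apply (insert assms static_arrs[OF assms(1,3)] static_regs[OF assms(1)])
  apply (cases "i \<in> A")
  apply (rule achieves_Then | (rule achieves_Block, simp) | rule achieves_If | rule achieves_Nop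
      | (auto simp: contribution_def; fail))+
  done

definition "L i = last_same q i n"

lemma L_eq_iff: "i < n \<Longrightarrow> j < n \<Longrightarrow> L i = L j \<longleftrightarrow> q i = q j"
  unfolding L_def using last_same[of i n q] last_same[of j n q] last_same_cong[of q i j n] by metis

lemma L_less: "i < n \<Longrightarrow> L i < n"
  unfolding L_def using last_same[of i n q] by simp

definition "cand m = (if m < n then c m else c (m - n) + d (m - n))"

definition prepared :: "machine_state \<Rightarrow> bool" where
  "prepared s \<longleftrightarrow> static s \<and> (\<forall>i<n. arrs s aL i = real (L i)) \<and> (\<forall>m<2 * n. arrs s aV m = cand m)"

lemma prepared_frame:
  assumes "prepared s" "frame R Q s s'"
    and "R \<inter> {rZero, rN, rN1, rN2, rN4, rGamma, rK} = {}" "Q \<inter> {aPart, aC, aD, aX, aL, aV} = {}"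
  shows "prepared s'"
  using assms static_frame[OF _ assms(2,3)] by (auto simp: prepared_def frame_def)

lemma prepared_upd [simp]:
  "r \<notin> {rZero, rN, rN1, rN2, rN4, rGamma, rK} \<Longrightarrow>
    prepared (s\<lparr>regs := f(r := v)\<rparr>) = prepared (s\<lparr>regs := f\<rparr>)"
  by (auto simp: prepared_def)

lemma prepared_static: "prepared s \<Longrightarrow> static s"
  by (simp add: prepared_def)

abbreviation table :: "real \<Rightarrow> nat set \<Rightarrow> (nat \<Rightarrow> real) set \<Rightarrow> (nat \<Rightarrow> real) \<Rightarrow> bool" where
  "table \<equiv> dual_dp.table n L A c d"

lemma process_items_correct:
  assumes s: "prepared s" "regs s rLam = lam" "regs s rMu = u" "regs s rR = real r"
    and G: "table lam {i. i < n \<and> L i < r} {mu\<in>M. mu r = u} (arrs s aG)"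
  shows "achieves n process_items s
    (\<lambda>s'. table lam {i. i < n \<and> L i < Suc r} {mu\<in>M. mu r = u} (arrs s' aG))"
proof -
  \<comment> \<open>The scan visits all items but handles only those labelled \<open>r\<close>: the
    earlier parts are complete, and of part \<open>r\<close> the items below \<open>m\<close> are
    done.\<close>
  define S where "S m = {i. i < n \<and> (L i < r \<or> L i = r \<and> i < m)}" for m
  define Inv where "Inv m s' \<longleftrightarrow> prepared s' \<and> regs s' rLam = lam \<and> regs s' rMu = u \<and>
    regs s' rR = real r \<and> table lam (S m) {mu\<in>M. mu r = u} (arrs s' aG)" for m s'
  have S0: "S 0 = {i. i < n \<and> L i < r}" by (auto simp: S_def)
  have Sn: "S n = {i. i < n \<and> L i < Suc r}" by (auto simp: S_def)
  have step: "achieves n (weights ;; row) s (Inv (Suc m))"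
    if "m < n" "regs s rI = real m" "Inv m s" "L m = r" for m s
  proof (rule achieves_Then'[OF weights_correct])
    show "static s" "regs s rI = real m" "m < n" "regs s rLam = lam" "regs s rMu = u"
      using that by (auto simp: Inv_def prepared_def)
    fix s1
    assume w: "regs s1 rW0 = contribution (m \<in> A) lam u (c m) \<and>
       regs s1 rW1 = contribution (m \<in> A) lam u (c m + d m)"
      and fr: "frame (written_regs weights) (written_arrs weights) s s1"
    have I1: "Inv m s1"
      using that(3) prepared_frame[OF _ fr] fr by (auto simp: Inv_def written frame_def)
    then have st: "regs s1 rZero = 0" "regs s1 rN = real n"
      using static_regs[OF prepared_static] by (auto simp: Inv_def)
    show "achieves n row s1 (Inv (Suc m))"
    proof (rule achieves_conseq[OF row_correct[OF st]])
      fix s2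
      assume r: "arrs s2 aG 0 = arrs s1 aG 0 + contribution (m \<in> A) lam u (c m) \<and>
         (\<forall>b<n. arrs s2 aG (Suc b) = max (arrs s1 aG (Suc b) + contribution (m \<in> A) lam u (c m))
           (arrs s1 aG b + contribution (m \<in> A) lam u (c m + d m)))"
        and fr: "frame (written_regs row) (written_arrs row) s1 s2"
      have S: "S (Suc m) = insert m (S m)" using that by (auto simp: S_def less_Suc_eq)
      have "table lam (S (Suc m)) {mu\<in>M. mu r = u} (arrs s2 aG)"
        unfolding S
      proof (rule dual_dp.table_item)
        show "table lam (S m) {mu\<in>M. mu r = u} (arrs s1 aG)" using I1 by (simp add: Inv_def)
      qed (use r that in \<open>auto simp: S_def\<close>)
      then show "Inv (Suc m) s2"
        using I1 prepared_frame[OF _ fr] fr by (auto simp: Inv_def written frame_def)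
    qed (use w in auto)
  qed
  show ?thesis unfolding process_items_def
  proof (rule achieves_For[where K = n and Inv = Inv])
    show "regs s rN = real n" using static_regs[OF prepared_static[OF s(1)]] by simp
    show "Inv 0 s" using s G by (simp add: Inv_def S0)
    fix m s
    assume m: "m < n" "regs s rN = real n" "regs s rI = real m" "Inv m s"
    have L: "arrs s aL m = real (L m)" using m by (simp add: Inv_def prepared_def)
    have "Inv (Suc m) (s\<lparr>regs := (regs s)(rX := real (L m))\<rparr>)" if "L m \<noteq> r"
    proof -
      have "S (Suc m) = S m" using that by (auto simp: S_def less_Suc_eq)
      then show ?thesis using m(4) by (simp add: Inv_def)
    qed
    moreover have "Inv m (s\<lparr>regs := (regs s)(rX := real (L m))\<rparr>)" using m(4) by (simp add: Inv_def)
    then have "L m = r \<Longrightarrow> achieves n (weights ;; row) (s\<lparr>regs := (regs s)(rX := real (L m))\<rparr>) (Inv (Suc m))"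
      using m by (intro step) auto
    ultimately show "achieves n
        (Block [Load rX aL rI] ;; If rX rR (If rR rX (weights ;; row) Nop) Nop) s (Inv (Suc m))"
      using m L
      apply -
      apply (rule achieves_Then, rule achieves_Block)
      apply simp
      apply (rule achieves_If achieves_Nop, simp_all add: Inv_def)+
      done
  qed (auto simp: Inv_def Sn written)
qed

end

lemma merge_correct:
  assumes "regs s rN1 = real (n + 1)" "regs s rM = real m" "regs s rZero = 0"
  shows "achieves n merge s (\<lambda>s'. \<forall>b\<le>n. arrs s' aH b =
    (if m = 0 then arrs s aG b else max (arrs s aH b) (arrs s aG b)))"
  unfolding merge_def
  apply (insert assms)
  apply (rule achieves_For[where K = "n + 1" and Inv = "\<lambda>k s'. arrs s' aG = arrs s aG \<and>
      regs s' rM = real m \<and> regs s' rZero = 0 \<and> (\<forall>b\<ge>k. arrs s' aH b = arrs s aH b) \<and>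
      (\<forall>b<k. arrs s' aH b = (if m = 0 then arrs s aG b else max (arrs s aH b) (arrs s aG b)))"])
            apply (simp_all add: less_Suc_eq_le del: of_nat_Suc of_nat_add)
  apply (cases "m = 0")
  apply (rule achieves_Then | (rule achieves_Block, simp) | rule achieves_If | rule achieves_Nop
      | (auto simp: le_less; fail))+
  done

context adversary
begin

lemma process_part_correct:
  assumes s: "prepared s" "regs s rLam = lam" "regs s rR = real r"
    and U: "\<forall>m<4 * n. arrs s aU m = u m" and n: "0 < n"
    and M: "M = {mu. \<forall>l. mu l \<in> u ` {..<4 * n}}"
    and F: "table lam {i. i < n \<and> L i < r} M (arrs s aF)"
  shows "achieves n process_part s (\<lambda>s'. table lam {i. i < n \<and> L i < Suc r} M (arrs s' aH))"
proof -
  let ?S = "{i. i < n \<and> L i < r}" and ?S' = "{i. i < n \<and> L i < Suc r}"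
  \<comment> \<open>Nothing is claimed about \<open>aH\<close> while \<open>m = 0\<close>, since it
    may hold data of the previous part until the first merge.\<close>
  define Inv where "Inv m s' \<longleftrightarrow> prepared s' \<and> regs s' rLam = lam \<and> regs s' rR = real r \<and>
    arrs s' aU = arrs s aU \<and> arrs s' aF = arrs s aF \<and>
    (0 < m \<longrightarrow> table lam ?S' {mu\<in>M. mu r \<in> u ` {..<m}} (arrs s' aH))" for m s'
  have body: "achieves n (copy aF aG ;; process_items ;; merge) s1 (Inv (Suc m))"
    if m: "m < 4 * n" "regs s1 rM = real m" "regs s1 rMu = u m" "Inv m s1" for m s1
  proof (rule achieves_Then'[OF copy_correct])
    show "regs s1 rN1 = real (n + 1)" using m static_regs[OF prepared_static] by (simp add: Inv_def)
    fix s2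
    assume copy: "\<forall>i\<le>n. arrs s2 aG i = arrs s1 aF i"
      and fr: "frame (written_regs (copy aF aG)) (written_arrs (copy aF aG)) s1 s2"
    have I2: "Inv m s2" "regs s2 rM = real m" "regs s2 rMu = u m"
      using m prepared_frame[OF _ fr] fr by (auto simp: Inv_def written frame_def)
    have "table lam ?S {mu\<in>M. mu r = u m} (arrs s1 aF)"
      using F m by (intro dual_dp.table_restrict) (auto simp: Inv_def M)
    then have G: "table lam ?S {mu\<in>M. mu r = u m} (arrs s2 aG)"
      by (rule dual_dp.table_cong) (use copy in simp)
    show "achieves n (process_items ;; merge) s2 (Inv (Suc m))"
    proof (rule achieves_Then'[OF process_items_correct])
      show "prepared s2" "regs s2 rLam = lam" "regs s2 rMu = u m" "regs s2 rR = real r"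
        using I2 by (auto simp: Inv_def)
      show "table lam ?S {mu\<in>M. mu r = u m} (arrs s2 aG)" by (rule G)
      fix s3
      assume G': "table lam ?S' {mu\<in>M. mu r = u m} (arrs s3 aG)"
        and fr: "frame (written_regs process_items) (written_arrs process_items) s2 s3"
      have I3: "Inv m s3" "regs s3 rM = real m"
        using I2 prepared_frame[OF _ fr] fr by (auto simp: Inv_def written frame_def)
      show "achieves n merge s3 (Inv (Suc m))"
      proof (rule achieves_conseq[OF merge_correct])
        show "regs s3 rN1 = real (n + 1)" "regs s3 rM = real m" "regs s3 rZero = 0"
          using I3 static_regs[OF prepared_static] by (auto simp: Inv_def)
        fix s4
        assume H: "\<forall>b\<le>n. arrs s4 aH b = (if m = 0 then arrs s3 aG b else max (arrs s3 aH b) (arrs s3 aG b))"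
          and fr: "frame (written_regs merge) (written_arrs merge) s3 s4"
        have "table lam ?S' {mu\<in>M. mu r \<in> u ` {..<Suc m}} (arrs s4 aH)"
        proof (cases "m = 0")
          case True
          then have "{mu\<in>M. mu r \<in> u ` {..<Suc m}} = {mu\<in>M. mu r = u m}" by auto
          then show ?thesis using dual_dp.table_cong[OF G'] H True by simp
        next
          case False
          then have "table lam ?S' {mu\<in>M. mu r \<in> u ` {..<m}} (arrs s3 aH)"
            using I3 by (simp add: Inv_def)
          from dual_dp.table_max[OF this G']
          have "table lam ?S' {mu\<in>M. mu r \<in> u ` {..<Suc m}} (\<lambda>b. max (arrs s3 aH b) (arrs s3 aG b))"
            by (simp add: lessThan_Suc)
          from dual_dp.table_cong[OF this] H False show ?thesis by simp
        qed
        then show "Inv (Suc m) s4"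
          using I3(1) prepared_frame[OF _ fr] fr by (auto simp: Inv_def written frame_def)
      qed
    qed
  qed simp
  show ?thesis unfolding process_part_def
  proof (rule achieves_For[where K = "4 * n" and Inv = Inv])
    show "regs s rN4 = real (4 * n)" using static_regs[OF prepared_static[OF s(1)]] by simp
    show "Inv 0 s" using s by (simp add: Inv_def)
    fix m s1
    assume m: "m < 4 * n" "regs s1 rN4 = real (4 * n)" "regs s1 rM = real m" "Inv m s1"
    have "Inv m (s1\<lparr>regs := (regs s1)(rMu := u m)\<rparr>)" using m(4) by (simp add: Inv_def)
    then have "achieves n (copy aF aG ;; process_items ;; merge) (s1\<lparr>regs := (regs s1)(rMu := u m)\<rparr>) (Inv (Suc m))"
      using m by (intro body) auto
    moreover have "arrs s1 aU m = u m" using m U by (simp add: Inv_def)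
    ultimately show "achieves n (Block [Load rMu aU rM] ;; copy aF aG ;; process_items ;; merge) s1 (Inv (Suc m))"
      using m by (intro achieves_Then achieves_Block) simp
  next
    fix s1 assume "Inv (4 * n) s1"
    \<comment> \<open>Once all candidates have been merged, the restriction on \<open>mu r\<close>
      is void.\<close>
    moreover have "{mu\<in>M. mu r \<in> u ` {..<4 * n}} = M" using M by auto
    ultimately show "table lam ?S' M (arrs s1 aH)" using n by (simp add: Inv_def)
  qed (auto simp: Inv_def written)
qed

lemma process_parts_correct:
  assumes s: "prepared s" "regs s rLam = lam"
    and U: "\<forall>m<4 * n. arrs s aU m = u m" and n: "0 < n"
    and M: "M = {mu. \<forall>l. mu l \<in> u ` {..<4 * n}}"
  shows "achieves n process_parts s (\<lambda>s'. table lam {..<n} M (arrs s' aF))"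
proof -
  define Inv where "Inv r s' \<longleftrightarrow> prepared s' \<and> regs s' rLam = lam \<and> arrs s' aU = arrs s aU \<and>
    table lam {i. i < n \<and> L i < r} M (arrs s' aF)" for r s'
  have init: "achieves n (For rB rN1 (Block [Store aF rB rZero])) s (\<lambda>s'. \<forall>b\<le>n. arrs s' aF b = 0)"
    apply (insert static_regs[OF prepared_static[OF s(1)]])
    apply (rule achieves_For[where K = "n + 1" and
          Inv = "\<lambda>m s'. regs s' rZero = 0 \<and> (\<forall>i<m. arrs s' aF i = 0)"])
              apply (simp_all add: less_Suc_eq_le del: of_nat_Suc of_nat_add)
    apply (rule achieves_Block, auto simp: le_less)
    done
  show ?thesis unfolding process_parts_def
  proof (rule achieves_Then'[OF init])
    fix s1
    assume F: "\<forall>b\<le>n. arrs s1 aF b = 0"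
      and fr: "frame (written_regs (For rB rN1 (Block [Store aF rB rZero])))
        (written_arrs (For rB rN1 (Block [Store aF rB rZero]))) s s1"
    have "M \<noteq> {}"
    proof -
      have "(\<lambda>_. u 0) \<in> M" using n by (auto simp: M)
      then show ?thesis by blast
    qed
    then have "table lam {} M (arrs s1 aF)"
      using dual_dp.table_cong[OF dual_dp.table_empty] F by blast
    then have I1: "Inv 0 s1"
      using s prepared_frame[OF _ fr] fr by (auto simp: Inv_def frame_def)
    show "achieves n (For rR rN (process_part ;; copy aH aF)) s1 (\<lambda>s'. table lam {..<n} M (arrs s' aF))"
    proof (rule achieves_For[where K = n and Inv = Inv])
      show "regs s1 rN = real n" using I1 static_regs[OF prepared_static] by (simp add: Inv_def)
      show "Inv 0 s1" by (rule I1)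
      fix r s2
      assume r: "r < n" "regs s2 rR = real r" "Inv r s2"
      show "achieves n (process_part ;; copy aH aF) s2 (Inv (Suc r))"
      proof (rule achieves_Then'[OF process_part_correct])
        show "prepared s2" "regs s2 rLam = lam" "regs s2 rR = real r" "\<forall>m<4 * n. arrs s2 aU m = u m"
          "table lam {i. i < n \<and> L i < r} M (arrs s2 aF)"
          using r U by (auto simp: Inv_def)
        fix s3
        assume H: "table lam {i. i < n \<and> L i < Suc r} M (arrs s3 aH)"
          and fr: "frame (written_regs process_part) (written_arrs process_part) s2 s3"
        have s3: "prepared s3" "regs s3 rLam = lam" "arrs s3 aU = arrs s aU"
          using r prepared_frame[OF _ fr] fr by (auto simp: Inv_def written frame_def)
        show "achieves n (copy aH aF) s3 (Inv (Suc r))"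
        proof (rule achieves_conseq[OF copy_correct])
          show "regs s3 rN1 = real (n + 1)" using static_regs[OF prepared_static[OF s3(1)]] by simp
          fix s4
          assume "\<forall>i\<le>n. arrs s4 aF i = arrs s3 aH i"
            and fr: "frame (written_regs (copy aH aF)) (written_arrs (copy aH aF)) s3 s4"
          then have "table lam {i. i < n \<and> L i < Suc r} M (arrs s4 aF)"
            using dual_dp.table_cong[OF H] by blast
          then show "Inv (Suc r) s4"
            using s3 prepared_frame[OF _ fr] fr by (auto simp: Inv_def written frame_def)
        qed simp
      qed (use n M in auto)
    next
      fix s2 assume "Inv n s2"
      moreover have "{i. i < n \<and> L i < n} = {..<n}" using L_less by auto
      ultimately show "table lam {..<n} M (arrs s2 aF)" by (simp add: Inv_def)
    qed (auto simp: Inv_def written)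
  qed
qed

definition "multiplier lam m = (if m < 2 * n then cand m else cand (m - 2 * n) + lam)"

lemma multipliers_correct:
  assumes s: "prepared s" "regs s rLam = lam"
  shows "achieves n multipliers s (\<lambda>s'. \<forall>m<4 * n. arrs s' aU m = multiplier lam m)"
proof -
  define Inv where "Inv m s' \<longleftrightarrow> regs s' rLam = lam \<and> arrs s' aV = arrs s aV \<and>
    (\<forall>i<m. arrs s' aU i = cand i \<and> arrs s' aU (2 * n + i) = cand i + lam)" for m and s' :: machine_state
  show ?thesis unfolding multipliers_def
  proof (rule achieves_For[where K = "2 * n" and Inv = Inv])
    show "regs s rN2 = real (2 * n)" using static_regs[OF prepared_static[OF s(1)]] by simp
    show "Inv 0 s" using s by (simp add: Inv_def)
    fix m s1
    assume m: "m < 2 * n" "regs s1 rN2 = real (2 * n)" "regs s1 rM = real m" "Inv m s1"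
    have "regs s1 rN2 + regs s1 rM = real (2 * n + m)" using m by simp
    moreover have "arrs s1 aV m = cand m" using m s by (simp add: Inv_def prepared_def)
    ultimately show "achieves n (Block [Load rX aV rM, Store aU rM rX, Arith Plus rX rX rLam,
        Arith Plus rY rN2 rM, Store aU rY rX]) s1 (Inv (Suc m))"
      using m(1,3,4) by (intro achieves_Block) (simp add: Inv_def less_Suc_eq del: of_nat_add)
  next
    fix s1 assume inv: "Inv (2 * n) s1"
    show "\<forall>m<4 * n. arrs s1 aU m = multiplier lam m"
    proof (intro allI impI)
      fix m assume m: "m < 4 * n"
      show "arrs s1 aU m = multiplier lam m"
      proof (cases "m < 2 * n")
        case False
        then obtain k where "m = 2 * n + k" using le_Suc_ex linorder_not_less by blast
        then show ?thesis using m inv by (simp add: Inv_def multiplier_def)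
      qed (use inv in \<open>simp add: Inv_def multiplier_def\<close>)
    qed
  qed (auto simp: Inv_def)
qed

lemma penalty_correct:
  assumes s: "prepared s" "regs s rLam = lam"
  shows "achieves n penalty s (\<lambda>s'. regs s' rPen = real (min (recovery I) n) * lam)"
proof -
  define Inv where "Inv m s' \<longleftrightarrow> regs s' rLam = lam \<and> regs s' rK = real (recovery I) \<and>
    regs s' rPen = real (min (recovery I) m) * lam" for m and s' :: machine_state
  have body: "achieves n (If rK rI Nop (Block [Arith Plus rPen rPen rLam])) s1 (Inv (Suc m))"
    if m: "regs s1 rI = real m" "Inv m s1" for m s1
  proof (rule achieves_If)
    assume "regs s1 rK \<le> regs s1 rI"
    then have "min (recovery I) (Suc m) = min (recovery I) m" using m by (simp add: Inv_def)
    then show "achieves n Nop s1 (Inv (Suc m))"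
      using m(2) by (intro achieves_Nop) (simp only: Inv_def)
  next
    assume "\<not> regs s1 rK \<le> regs s1 rI"
    then have "min (recovery I) (Suc m) = Suc m" "min (recovery I) m = m"
      using m by (simp_all add: Inv_def)
    then show "achieves n (Block [Arith Plus rPen rPen rLam]) s1 (Inv (Suc m))"
      using m(2) unfolding Inv_def by (intro achieves_Block) (simp add: algebra_simps)
  qed
  show ?thesis unfolding penalty_def
    apply (insert s static_regs[OF prepared_static[OF s(1)]])
    apply (rule achieves_Then, rule achieves_Block, simp)
    apply (rule achieves_For[where K = n and Inv = Inv])
              apply (simp_all add: body Inv_def[of 0] del: of_nat_min)
     apply (simp_all add: Inv_def)
    done
qed

section \<open>Searching all pairs of candidate costs\<close>

definition "gap s t = max 0 (cand s - cand t)"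

text \<open>All components range independently over one finite list; this gives the closure under
  updates that \<open>table_restrict\<close> asks for.\<close>

definition "multiplier_set lam = {mu. \<forall>l. mu l \<in> multiplier lam ` {..<4 * n}}"

definition "dual_value s t mu Z =
  dual_sum {..<n} L A (gap s t) mu (dev_cost c d Z) - real (min (recovery I) n) * gap s t"

definition attained :: "nat \<times> nat \<Rightarrow> real \<Rightarrow> bool" where
  "attained = (\<lambda>(s, t) v. \<exists>mu\<in>multiplier_set (gap s t). \<exists>Z.
     card ({..<n} \<inter> Z) \<le> min (budget I) n \<and> v = dual_value s t mu Z)"

definition bounded_by :: "nat \<times> nat \<Rightarrow> real \<Rightarrow> bool" where
  "bounded_by = (\<lambda>(s, t) v. \<forall>mu\<in>multiplier_set (gap s t). \<forall>Z.
     card ({..<n} \<inter> Z) \<le> min (budget I) n \<longrightarrow> dual_value s t mu Z \<le> v)"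

definition best :: "(nat \<times> nat) set \<Rightarrow> real \<Rightarrow> bool" where
  "best P v \<longleftrightarrow> (\<exists>p\<in>P. attained p v) \<and> (\<forall>p\<in>P. bounded_by p v)"

lemma bounded_by_mono:
  assumes "bounded_by p v" "v \<le> w"
  shows "bounded_by p w"
proof -
  obtain s t where p: "p = (s, t)" by fastforce
  show ?thesis
    using assms(1) order_trans[OF _ assms(2)] unfolding p bounded_by_def prod.case by blast
qed

lemma best_insert:
  assumes P: "best P v" and p: "best {p} w"
  shows "best (insert p P) (max v w)"
proof -
  have "bounded_by r (max v w)" if "r \<in> insert p P" for r
  proof (cases "r = p")
    case True
    then have "bounded_by r w" using p by (simp add: best_def)
    then show ?thesis by (rule bounded_by_mono) simp
  next
    case False
    then have "bounded_by r v" using that P by (simp add: best_def)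
    then show ?thesis by (rule bounded_by_mono) simp
  qed
  moreover have "\<exists>r\<in>insert p P. attained r (max v w)"
    using P p by (simp add: best_def max_def)
  ultimately show ?thesis unfolding best_def by blast
qed

lemma evaluate_correct:
  assumes s: "prepared st" "regs st rS = real s" "regs st rT = real t" "s < 2 * n" "t < 2 * n"
  shows "achieves n evaluate st (\<lambda>st'. best {(s, t)} (regs st' rX))"
proof -
  let ?lam = "gap s t"
  define Inv where "Inv st' \<longleftrightarrow> prepared st' \<and> regs st' rLam = ?lam" for st'
  have n: "0 < n" using s by simp
  have rest: "achieves n (penalty ;; multipliers ;; process_parts ;;
      Block [Load rX aF rGamma, Arith Minus rX rX rPen]) s0 (\<lambda>st'. best {(s, t)} (regs st' rX))"
    if "Inv s0" for s0
  proof (rule achieves_Then'[OF penalty_correct])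
    show "prepared s0" "regs s0 rLam = ?lam" using that by (auto simp: Inv_def)
    fix s1
    assume pen: "regs s1 rPen = real (min (recovery I) n) * ?lam"
      and fr: "frame (written_regs penalty) (written_arrs penalty) s0 s1"
    have I1: "Inv s1" using that prepared_frame[OF _ fr] fr by (auto simp: Inv_def written frame_def)
    show "achieves n (multipliers ;; process_parts ;;
      Block [Load rX aF rGamma, Arith Minus rX rX rPen]) s1 (\<lambda>st'. best {(s, t)} (regs st' rX))"
    proof (rule achieves_Then'[OF multipliers_correct])
      show "prepared s1" "regs s1 rLam = ?lam" using I1 by (auto simp: Inv_def)
      fix s2
      assume U: "\<forall>m<4 * n. arrs s2 aU m = multiplier ?lam m"
        and fr: "frame (written_regs multipliers) (written_arrs multipliers) s1 s2"
      have I2: "Inv s2" "regs s2 rPen = regs s1 rPen"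
        using I1 prepared_frame[OF _ fr] fr by (auto simp: Inv_def written frame_def)
      show "achieves n (process_parts ;;
        Block [Load rX aF rGamma, Arith Minus rX rX rPen]) s2 (\<lambda>st'. best {(s, t)} (regs st' rX))"
      proof (rule achieves_Then'[OF process_parts_correct])
        show "prepared s2" "regs s2 rLam = ?lam" using I2 by (auto simp: Inv_def)
        show "multiplier_set ?lam = {mu. \<forall>l. mu l \<in> multiplier ?lam ` {..<4 * n}}"
          by (simp add: multiplier_set_def)
        fix s3
        assume F: "table ?lam {..<n} (multiplier_set ?lam) (arrs s3 aF)"
          and fr: "frame (written_regs process_parts) (written_arrs process_parts) s2 s3"
        have s3: "prepared s3" "regs s3 rPen = real (min (recovery I) n) * ?lam"
          using I2 pen prepared_frame[OF _ fr] fr by (auto simp: Inv_def written frame_def)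
        have gam: "regs s3 rGamma = real (min (budget I) n)"
          using static_regs[OF prepared_static[OF s3(1)]] by simp
        define G where "G = arrs s3 aF (min (budget I) n)"
        have "min (budget I) n \<le> n" by simp
        then have "\<exists>Z. \<exists>mu\<in>multiplier_set ?lam. card ({..<n} \<inter> Z) \<le> min (budget I) n \<and>
            G = dual_sum {..<n} L A ?lam mu (dev_cost c d Z)"
          and "\<forall>Z. \<forall>mu\<in>multiplier_set ?lam. card ({..<n} \<inter> Z) \<le> min (budget I) n \<longrightarrow>
            dual_sum {..<n} L A ?lam mu (dev_cost c d Z) \<le> G"
          using F unfolding dual_dp.table_def G_def by blast+
        then have "attained (s, t) (G - regs s3 rPen)" "bounded_by (s, t) (G - regs s3 rPen)"
          unfolding attained_def bounded_by_def dual_value_def s3(2) prod.case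
          by (blast, simp del: of_nat_min)
        then have "best {(s, t)} (arrs s3 aF (min (budget I) n) - regs s3 rPen)"
          by (simp add: best_def G_def)
        then show "achieves n (Block [Load rX aF rGamma, Arith Minus rX rX rPen]) s3
            (\<lambda>st'. best {(s, t)} (regs st' rX))"
          using gam by (intro achieves_Block) (simp del: of_nat_min)
      qed (use U n in auto)
    qed
  qed
  have V: "arrs st aV s = cand s" "arrs st aV t = cand t" using s by (auto simp: prepared_def)
  show ?thesis unfolding evaluate_def
    apply (insert s(1-3) V static_regs[OF prepared_static[OF s(1)]])
    apply (rule achieves_Then, rule achieves_Block, simp)
    apply (rule achieves_Then, rule achieves_If)
     apply (rule achieves_Block, simp)
     apply (rule rest, simp add: Inv_def gap_def)
    apply (rule achieves_Nop)
    apply (rule rest, simp add: Inv_def gap_def)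
    done
qed

definition searched :: "nat \<Rightarrow> nat \<Rightarrow> (nat \<times> nat) set" where
  "searched s t = {(s', t'). t' < 2 * n \<and> (s' < s \<or> s' = s \<and> t' < t)}"

text \<open>Before the first pair there is no best value yet. The value 0 required then is also the
  final result when \<open>n = 0\<close>.\<close>

definition search_inv :: "nat \<Rightarrow> nat \<Rightarrow> machine_state \<Rightarrow> bool" where
  "search_inv s t st \<longleftrightarrow> prepared st \<and>
    (if s = 0 \<and> t = 0 then regs st rBest = 0 else best (searched s t) (regs st rBest))"

lemma search_inv_upd [simp]:
  "r \<notin> {rBest, rZero, rN, rN1, rN2, rN4, rGamma, rK} \<Longrightarrow>
    search_inv s t (st\<lparr>regs := f(r := v)\<rparr>) = search_inv s t (st\<lparr>regs := f\<rparr>)"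
  by (simp add: search_inv_def)

lemma search_step:
  assumes st: "search_inv s t st" "regs st rS = real s" "regs st rT = real t" "s < 2 * n" "t < 2 * n"
  shows "achieves n (evaluate ;; Block [Arith Plus rY rS rT] ;;
     If rY rZero (Block [Move rBest rX]) (If rX rBest Nop (Block [Move rBest rX])))
     st (search_inv s (Suc t))"
proof (rule achieves_Then'[OF evaluate_correct])
  show "prepared st" "regs st rS = real s" "regs st rT = real t" "s < 2 * n" "t < 2 * n"
    using st by (auto simp: search_inv_def)
  fix s1
  assume b: "best {(s, t)} (regs s1 rX)"
    and fr: "frame (written_regs evaluate) (written_arrs evaluate) st s1"
  have s1: "search_inv s t s1" "regs s1 rS = real s" "regs s1 rT = real t"
    using st prepared_frame[OF _ fr] fr by (auto simp: search_inv_def written frame_def)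
  then have P1: "prepared s1" by (simp add: search_inv_def)
  have S: "searched s (Suc t) = insert (s, t) (searched s t)"
    using st by (auto simp: searched_def less_Suc_eq)
  have S0: "searched 0 0 = {}" by (auto simp: searched_def)
  have first: "search_inv s (Suc t) (s1\<lparr>regs := f(rBest := regs s1 rX)\<rparr>)"
    if "s = 0" "t = 0" "f = (regs s1)(rY := v)" for f v
    using b that P1 S S0 by (simp add: search_inv_def)
  have keep: "search_inv s (Suc t) (s1\<lparr>regs := (regs s1)(rY := v)\<rparr>)"
    if "\<not> (s = 0 \<and> t = 0)" "regs s1 rX \<le> regs s1 rBest" for v
    using best_insert[OF _ b, of "searched s t" "regs s1 rBest"] s1(1) that P1
    by (auto simp: search_inv_def S max_absorb1)
  have replace: "search_inv s (Suc t) (s1\<lparr>regs := (regs s1)(rY := v, rBest := regs s1 rX)\<rparr>)"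
    if "\<not> (s = 0 \<and> t = 0)" "\<not> regs s1 rX \<le> regs s1 rBest" for v
    using best_insert[OF _ b, of "searched s t" "regs s1 rBest"] s1(1) that P1
    by (auto simp: search_inv_def S max_absorb2)
  have zero: "regs s1 rZero = 0" using static_regs[OF prepared_static[OF P1]] by simp
  show "achieves n (Block [Arith Plus rY rS rT] ;;
     If rY rZero (Block [Move rBest rX]) (If rX rBest Nop (Block [Move rBest rX])))
     s1 (search_inv s (Suc t))"
    apply (insert s1(2,3) zero)
    apply (rule achieves_Then, rule achieves_Block, simp)
    apply (rule achieves_If, rule achieves_Block, simp add: first)
    apply (rule achieves_If, rule achieves_Nop, rule keep, fastforce, simp)
    apply (rule achieves_Block, simp, rule replace, fastforce, simp)
    done
qed

lemma search_correct:
  assumes "prepared st" "regs st rBest = 0"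
  shows "achieves n search st (search_inv (2 * n) 0)"
  unfolding search_def
proof (rule achieves_For[where K = "2 * n" and Inv = "\<lambda>s. search_inv s 0"])
  show "regs st rN2 = real (2 * n)" using static_regs[OF prepared_static[OF assms(1)]] by simp
  show "search_inv 0 0 st" using assms by (simp add: search_inv_def)
  fix s st
  assume s: "s < 2 * n" "regs st rN2 = real (2 * n)" "regs st rS = real s" "search_inv s 0 st"
  show "achieves n (For rT rN2 (evaluate ;; Block [Arith Plus rY rS rT] ;;
     If rY rZero (Block [Move rBest rX]) (If rX rBest Nop (Block [Move rBest rX]))))
     st (search_inv (Suc s) 0)"
  proof (rule achieves_For[where K = "2 * n" and Inv = "\<lambda>t st. regs st rS = real s \<and> search_inv s t st"])
    fix t st
    assume t: "t < 2 * n" "regs st rN2 = real (2 * n)" "regs st rT = real t"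
      "regs st rS = real s \<and> search_inv s t st"
    show "achieves n (evaluate ;; Block [Arith Plus rY rS rT] ;;
       If rY rZero (Block [Move rBest rX]) (If rX rBest Nop (Block [Move rBest rX])))
       st (\<lambda>st. regs st rS = real s \<and> search_inv s (Suc t) st)"
      by (rule achieves_conseq[OF search_step])
        (use s t in \<open>auto simp: frame_def written\<close>)
  next
    fix st assume "regs st rS = real s \<and> search_inv s (2 * n) st"
    moreover have "searched s (2 * n) = searched (Suc s) 0"
      by (auto simp: searched_def less_Suc_eq)
    ultimately show "search_inv (Suc s) 0 st" using s by (auto simp: search_inv_def)
  qed (use s in \<open>auto simp: written\<close>)
qed (auto simp: written)

lemma dev_cost_cand:
  assumes "i < n"
  shows "\<exists>m<2 * n. dev_cost c d Z i = cand m"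
  using assms by (intro exI[of _ "if i \<in> Z then n + i else i"]) (auto simp: dev_cost_def cand_def)

text \<open>Weak duality keeps every searched value below the adversarial value. Conversely, an
  optimal dual solution occurs in the search, because each cost under a deviating set is one of the
  \<open>2 n\<close> candidates.\<close>

lemma best_eq_Adv:
  assumes n: "0 < n" and v: "best (searched (2 * n) 0) v"
  shows "v = Adv I x"
proof (rule antisym)
  obtain s t mu Z where "card ({..<n} \<inter> Z) \<le> min (budget I) n" "v = dual_value s t mu Z"
    using v by (auto simp: best_def attained_def)
  then show "v \<le> Adv I x"
    using dual_le_Adv[OF L_eq_iff, of "gap s t" Z mu] by (simp add: dual_value_def gap_def)
next
  obtain Z i j lam mu where Z: "card ({..<n} \<inter> Z) \<le> min (budget I) n" and ij: "i < n" "j < n"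
    and lam: "lam = max 0 (dev_cost c d Z i - dev_cost c d Z j)"
    and mu: "\<And>r. \<exists>i<n. mu r = dev_cost c d Z i \<or> mu r = dev_cost c d Z i + lam"
    and le: "Adv I x \<le> dual_sum {..<n} L A lam mu (dev_cost c d Z) - real (min (recovery I) n) * lam"
    using Adv_le_dual[OF L_eq_iff n] by blast
  obtain s t where st: "s < 2 * n" "t < 2 * n" "lam = gap s t"
    using dev_cost_cand[OF ij(1), of Z] dev_cost_cand[OF ij(2), of Z] lam
    unfolding gap_def by metis
  have "mu r \<in> multiplier lam ` {..<4 * n}" for r
  proof -
    obtain i where i: "i < n" "mu r = dev_cost c d Z i \<or> mu r = dev_cost c d Z i + lam"
      using mu by blast
    then obtain m where m: "m < 2 * n" "dev_cost c d Z i = cand m" using dev_cost_cand by blast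
    from i(2) have "mu r = multiplier lam m \<or> mu r = multiplier lam (2 * n + m)"
      using m by (auto simp: multiplier_def)
    then show ?thesis using m(1) by auto
  qed
  then have "mu \<in> multiplier_set (gap s t)" using st(3) by (simp add: multiplier_set_def)
  moreover have "(s, t) \<in> searched (2 * n) 0" using st by (simp add: searched_def)
  ultimately have "dual_value s t mu Z \<le> v" using v Z by (auto simp: best_def bounded_by_def)
  then show "Adv I x \<le> v" using le st(3) by (simp add: dual_value_def)
qed

end

section \<open>Labels, candidate costs and initialization\<close>

lemma written_leaders:
  "written_regs leaders = {1, rI, rJ, rX, rY}" "written_arrs leaders = {aL}"
  by (auto simp: leaders_def)

lemma written_candidate_costs:
  "written_regs candidate_costs = {1, rI, rJ, rX, rY}" "written_arrs candidate_costs = {aV}"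
  by (auto simp: candidate_costs_def)

context adversary
begin

lemma leaders_correct:
  assumes s: "static s" "\<forall>i. arrs s aL i = 0"
  shows "achieves n leaders s (\<lambda>s'. \<forall>i<n. arrs s' aL i = real (L i))"
proof -
  \<comment> \<open>Row \<open>i\<close> has compared the items below \<open>j\<close>. Entries
    above \<open>i\<close> are still 0, which is the value of \<open>last_same\<close> at the start
    of their rows.\<close>
  define Inv where "Inv i j s' \<longleftrightarrow> static s' \<and> (\<forall>k<i. arrs s' aL k = real (L k)) \<and>
    (i < n \<longrightarrow> arrs s' aL i = real (last_same q i j)) \<and> (\<forall>k>i. arrs s' aL k = 0)" for i j s'
  have upd: "Inv i j (s\<lparr>regs := f(r := v)\<rparr>) = Inv i j (s\<lparr>regs := f\<rparr>)"
    if "r \<notin> {rZero, rN, rN1, rN2, rN4, rGamma, rK}" for i j s f r v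
    using that by (simp add: Inv_def)
  have body: "achieves n (Block [Load rX aPart rI, Load rY aPart rJ] ;;
      If rX rY (If rY rX (Block [Store aL rI rJ]) Nop) Nop) s1 (\<lambda>s'. regs s' rI = real i \<and> Inv i (Suc j) s')"
    if "i < n" "j < n" "regs s1 rI = real i" "regs s1 rJ = real j" "Inv i j s1" for i j s1
  proof -
    have parts: "arrs s1 aPart i = real (q i)" "arrs s1 aPart j = real (q j)"
      using that static_arrs by (auto simp: Inv_def)
    let ?s = "s1\<lparr>regs := (regs s1)(rX := real (q i), rY := real (q j))\<rparr>"
    have keep: "Inv i (Suc j) ?s" if "q i \<noteq> q j"
      using that \<open>Inv i j s1\<close> by (simp add: Inv_def)
    have set: "Inv i (Suc j) (?s\<lparr>arrs := (arrs s1)(aL := (arrs s1 aL)(i := real j))\<rparr>)" if "q i = q j"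
      using that \<open>Inv i j s1\<close> by (simp add: Inv_def static_def)
    show ?thesis
      apply (insert that(3,4) parts)
      apply (rule achieves_Then, rule achieves_Block, simp)
      apply (rule achieves_If)
       apply (rule achieves_If)
        apply (rule achieves_Block)
      using set apply simp
       apply (rule achieves_Nop)
      using keep apply simp
      apply (rule achieves_Nop)
      using keep apply simp
      done
  qed
  show ?thesis unfolding leaders_def
  proof (rule achieves_For[where K = n and Inv = "\<lambda>i. Inv i 0"])
    show "regs s rN = real n" using static_regs[OF s(1)] by simp
    show "Inv 0 0 s" using s by (simp add: Inv_def)
    fix i s1
    assume i: "i < n" "regs s1 rN = real n" "regs s1 rI = real i" "Inv i 0 s1"
    show "achieves n (For rJ rN (Block [Load rX aPart rI, Load rY aPart rJ] ;;
      If rX rY (If rY rX (Block [Store aL rI rJ]) Nop) Nop)) s1 (Inv (Suc i) 0)"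
    proof (rule achieves_For[where K = n and Inv = "\<lambda>j s. regs s rI = real i \<and> Inv i j s"])
      fix s2 assume "regs s2 rI = real i \<and> Inv i n s2"
      then show "Inv (Suc i) 0 s2" using i(1) by (auto simp: Inv_def less_Suc_eq L_def)
    qed (use i body in \<open>auto simp: upd\<close>)
  qed (auto simp: upd, auto simp: Inv_def)
qed

lemma candidate_costs_correct:
  assumes s: "static s"
  shows "achieves n candidate_costs s (\<lambda>s'. \<forall>m<2 * n. arrs s' aV m = cand m)"
proof -
  define Inv where "Inv m s' \<longleftrightarrow> static s' \<and>
    (\<forall>i<m. arrs s' aV i = c i \<and> arrs s' aV (n + i) = c i + d i)" for m s'
  show ?thesis unfolding candidate_costs_def
  proof (rule achieves_For[where K = n and Inv = Inv])
    show "regs s rN = real n" using static_regs[OF s(1)] by simp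
    show "Inv 0 s" using s by (simp add: Inv_def)
    fix m s1
    assume m: "m < n" "regs s1 rN = real n" "regs s1 rI = real m" "Inv m s1"
    then have "arrs s1 aC m = c m" "arrs s1 aD m = d m" using static_arrs by (auto simp: Inv_def)
    then show "achieves n (Block [Load rX aC rI, Store aV rI rX, Load rY aD rI, Arith Plus rX rX rY,
        Arith Plus rJ rN rI, Store aV rJ rX]) s1 (Inv (Suc m))"
      using m by (intro achieves_Block) (simp add: Inv_def static_def less_Suc_eq)
  next
    fix s1 assume inv: "Inv n s1"
    show "\<forall>m<2 * n. arrs s1 aV m = cand m"
    proof (intro allI impI)
      fix m assume m: "m < 2 * n"
      show "arrs s1 aV m = cand m"
      proof (cases "m < n")
        case False
        then obtain k where "m = n + k" using le_Suc_ex linorder_not_less by blast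
        then show ?thesis using m inv by (simp add: Inv_def cand_def)
      qed (use inv in \<open>simp add: Inv_def cand_def\<close>)
    qed
  qed (auto simp: Inv_def)
qed

lemma initial_arrs:
  fixes s0 defines "s0 \<equiv> initial_state (encode I x)"
  shows "arrs s0 0 0 = real n" "arrs s0 0 2 = real (budget I)" "arrs s0 0 3 = real (recovery I)"
    and "\<And>i. i < n \<Longrightarrow> arrs s0 aPart i = real (q i)" "\<And>i. i < n \<Longrightarrow> arrs s0 aC i = c i"
    "\<And>i. i < n \<Longrightarrow> arrs s0 aD i = d i" "\<And>i. i < n \<Longrightarrow> arrs s0 aX i = (if i \<in> A then 1 else 0)"
    and "\<And>i. arrs s0 aL i = 0"
proof -
  have x: "x (Suc i) = (if i \<in> A then 1 else 0)" if "i < n" for i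
    using that by (subst x_eq) (simp add: indicator_vec_Suc n_def)
  show "arrs s0 0 0 = real n" "arrs s0 0 2 = real (budget I)" "arrs s0 0 3 = real (recovery I)"
    and "\<And>i. i < n \<Longrightarrow> arrs s0 aPart i = real (q i)" "\<And>i. i < n \<Longrightarrow> arrs s0 aC i = c i"
    "\<And>i. i < n \<Longrightarrow> arrs s0 aD i = d i" "\<And>i. i < n \<Longrightarrow> arrs s0 aX i = (if i \<in> A then 1 else 0)"
    and "\<And>i. arrs s0 aL i = 0"
    unfolding s0_def initial_state_def encode_def Let_def n_def[symmetric]
    by (simp_all add: x q_def c_def d_def nth_append eval_nat_numeral nth_upt del: upt_Suc)
qed

lemma setup_correct:
  "achieves n setup_regs (initial_state (encode I x)) static"
proof -
  have regs: "regs (initial_state (encode I x)) r = 0" for r by (simp add: initial_state_def)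
  show ?thesis
    unfolding setup_regs_def
    apply (insert initial_arrs regs)
    apply (rule achieves_Then, rule achieves_Block, simp)
    apply (rule achieves_If)
     apply (rule achieves_Block, simp add: static_def)
    apply (rule achieves_Nop, simp add: static_def)
    done
qed

lemma adv_code_correct:
  "achieves n adv_code (initial_state (encode I x)) (\<lambda>s. regs s 0 = Adv I x)"
  unfolding adv_code_def
proof (rule achieves_Then'[OF setup_correct])
  let ?s0 = "initial_state (encode I x)"
  fix s1
  assume s1: "static s1" and fr: "frame (written_regs setup_regs) (written_arrs setup_regs) ?s0 s1"
  have z1: "regs s1 rBest = 0" "\<forall>i. arrs s1 aL i = 0"
    using fr initial_arrs(8) by (auto simp: frame_def setup_regs_def initial_state_def)
  show "achieves n (leaders ;; candidate_costs ;; search) s1 (\<lambda>s. regs s 0 = Adv I x)"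
  proof (rule achieves_Then'[OF leaders_correct[OF s1 z1(2)]])
    fix s2
    assume L: "\<forall>i<n. arrs s2 aL i = real (L i)"
      and fr: "frame (written_regs leaders) (written_arrs leaders) s1 s2"
    have s2: "static s2" "regs s2 rBest = 0"
      using static_frame[OF s1 fr] z1 fr by (auto simp: written_leaders frame_def)
    show "achieves n (candidate_costs ;; search) s2 (\<lambda>s. regs s 0 = Adv I x)"
    proof (rule achieves_Then'[OF candidate_costs_correct[OF s2(1)]])
      fix s3
      assume V: "\<forall>m<2 * n. arrs s3 aV m = cand m"
        and fr: "frame (written_regs candidate_costs) (written_arrs candidate_costs) s2 s3"
      have s3: "prepared s3" "regs s3 rBest = 0"
        using static_frame[OF s2(1) fr] s2(2) L V fr
        by (auto simp: written_candidate_costs frame_def prepared_def)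
      show "achieves n search s3 (\<lambda>s. regs s 0 = Adv I x)"
      proof (rule achieves_conseq[OF search_correct[OF s3]])
        fix s assume s: "search_inv (2 * n) 0 s"
        show "regs s 0 = Adv I x"
        proof (cases "n = 0")
          case True
          then show ?thesis using s Adv_no_items by (simp add: search_inv_def)
        next
          case False
          then show ?thesis using s best_eq_Adv by (simp add: search_inv_def)
        qed
      qed
    qed
  qed
qed

lemma n_le_input_size: "n \<le> input_size (encode I x)"
proof -
  have "n \<le> length (concat (encode I x))" by (simp add: encode_def Let_def n_def del: upt_Suc)
  also have "\<dots> \<le> input_size (encode I x)"
    unfolding input_size_def by (rule length_le_sum_number_size)
  finally show ?thesis .
qed

end

text \<open>The largest constant in the program is 3, an array position, and this is below
  \<open>2^2\<close>.\<close>

lemma additive_adv_code: "additive 2 (compile adv_code)"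
  by (simp add: adv_code_def setup_regs_def leaders_def candidate_costs_def search_def evaluate_def
      penalty_def multipliers_def process_parts_def process_part_def copy_def merge_def
      process_items_def weights_def row_def)

theorem theorem1:
  "strongly_polynomial_time adversarial_inputs
     (\<lambda>(I, x). num_items I) (\<lambda>(I, x). encode I x) (\<lambda>(I, x). Adv I x)"
proof (rule additive_strongly_polynomial[where T = "cost adv_code"])
  show "additive 2 (compile adv_code)" by (rule additive_adv_code)
  fix Ix assume "Ix \<in> adversarial_inputs"
  then obtain I x where Ix: "Ix = (I, x)" "valid_instance I" "x \<in> feasible I"
    by (auto simp: adversarial_inputs_def)
  interpret adversary I x by standard (use Ix in auto)
  show "\<exists>t s. t \<le> poly (cost adv_code) (case Ix of (I, x) \<Rightarrow> num_items I) \<and>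
      runs (compile adv_code) (initial_state (case Ix of (I, x) \<Rightarrow> encode I x)) t Skip s \<and>
      regs s 0 = (case Ix of (I, x) \<Rightarrow> Adv I x)"
    using adv_code_correct unfolding achieves_def Ix(1) n_def by auto
  show "(case Ix of (I, x) \<Rightarrow> num_items I) \<le> input_size (case Ix of (I, x) \<Rightarrow> encode I x)"
    using n_le_input_size unfolding Ix(1) n_def by simp
qed

end
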